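(* There exist a $\sigma$-finite measure space $(\Omega,\mathcal{B},\mu)$ with $\mu(\Omega)=\infty$, a conservative, invertible, ergodic, measure-preserving transformation $T:\Omega\to\Omega$, a bounded measurable function $f:\Omega\to\mathbb{R}$, and an increasing sequence $F_1\subseteq F_2\subseteq\cdots$ of measurable sets of finite positive $\mu$-measure with $\bigcup_{l}F_l=\Omega$, such that the probability measures $dk^l$ on $\mathbb{R}$ determined by $$\int g(E)\,dk^l(E)=\frac1{\mu(F_l)}\int_{F_l}\langle\delta_0,g(H_\omega)\delta_0\rangle\,d\mu(\omega)\qquad\text{for all continuous compactly supported } g$$ do not converge weakly as $l\to\infty$. Here $H_\omega$ is the bounded self-adjoint operator on $\ell^2(\mathbb{Z})$ given by $(H_\omega u)_n=u_{n-1}+u_{n+1}+f(T^n\omega)u_n$.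
   Context: A measurable transformation $T$ is: invertible if it is bijective and $T^{-1}$ is measurable; measure-preserving if $\mu(T^{-1}E)=\mu(E)$ for all $E\in\mathcal{B}$; ergodic if $T^{-1}E=E$ (with $E\in\mathcal{B}$) implies $\mu(E)=0$ or $\mu(\Omega\setminus E)=0$; conservative if there is no $W\in\mathcal{B}$ with $\mu(W)>0$ such that the sets $T^{-n}W$, $n\ge 0$, are pairwise disjoint. $\{\delta_n\}_{n\in\mathbb{Z}}$ is the standard basis of $\ell^2(\mathbb{Z})$. Weak convergence of measures is convergence of integrals of bounded continuous functions. *)

theory Defs
  imports "HOL-Probability.Probability" "HOL-Computational_Algebra.Polynomial"
begin

section \<open>The complex Hilbert space of square-summable two-sided sequences\<close>

typedef ell2 = "{x :: int \<Rightarrow> complex. (\<lambda>n. (cmod (x n))\<^sup>2) summable_on UNIV}"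
  morphisms ell2_nth Abs_ell2
  by (rule exI[of _ "\<lambda>_. 0"]) simp

lemma ell2_nth_square_summable: "(\<lambda>n. (cmod (ell2_nth x n))\<^sup>2) summable_on UNIV"
  using ell2_nth by blast

lemma ell2_nth_Abs:
  "(\<lambda>n. (cmod (x n))\<^sup>2) summable_on UNIV \<Longrightarrow> ell2_nth (Abs_ell2 x) = x"
  by (simp add: Abs_ell2_inverse)

lemma ell2_eqI: "(\<And>n. ell2_nth x n = ell2_nth y n) \<Longrightarrow> x = y"
  by (metis ell2_nth_inject ext)

lemma square_summable_mult_bounded:
  fixes v x :: "int \<Rightarrow> complex"
  assumes x: "(\<lambda>n. (cmod (x n))\<^sup>2) summable_on UNIV" and v: "\<And>n. cmod (v n) \<le> C"
  shows "(\<lambda>n. (cmod (v n * x n))\<^sup>2) summable_on UNIV"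
proof (rule summable_on_comparison_test)
  show "(\<lambda>n. C\<^sup>2 * (cmod (x n))\<^sup>2) summable_on UNIV"
    using x by (rule summable_on_cmult_right)
  show "(cmod (v n * x n))\<^sup>2 \<le> C\<^sup>2 * (cmod (x n))\<^sup>2" for n
    by (simp add: norm_mult power_mult_distrib power_mono mult_right_mono v)
qed simp

lemma square_summable_add:
  fixes x y :: "int \<Rightarrow> complex"
  assumes x: "(\<lambda>n. (cmod (x n))\<^sup>2) summable_on UNIV"
    and y: "(\<lambda>n. (cmod (y n))\<^sup>2) summable_on UNIV"
  shows "(\<lambda>n. (cmod (x n + y n))\<^sup>2) summable_on UNIV"
proof (rule summable_on_comparison_test)
  show "(\<lambda>n. 2 * (cmod (x n))\<^sup>2 + 2 * (cmod (y n))\<^sup>2) summable_on UNIV"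
    by (intro summable_on_add summable_on_cmult_right x y)
  show "(cmod (x n + y n))\<^sup>2 \<le> 2 * (cmod (x n))\<^sup>2 + 2 * (cmod (y n))\<^sup>2" for n
  proof -
    have "(cmod (x n + y n))\<^sup>2 \<le> (cmod (x n) + cmod (y n))\<^sup>2"
      by (simp add: norm_triangle_ineq power_mono)
    also have "\<dots> \<le> 2 * (cmod (x n))\<^sup>2 + 2 * (cmod (y n))\<^sup>2"
      using zero_le_power2[of "cmod (x n) - cmod (y n)"]
      by (simp add: power2_eq_square algebra_simps)
    finally show ?thesis .
  qed
qed simp

lemma square_summable_shift:
  fixes x :: "int \<Rightarrow> complex"
  assumes "(\<lambda>n. (cmod (x n))\<^sup>2) summable_on UNIV"
  shows "(\<lambda>n. (cmod (x (n + k)))\<^sup>2) summable_on UNIV"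
proof -
  have "bij_betw (\<lambda>n::int. n + k) UNIV UNIV"
    by (rule bij_betw_byWitness[where f' = "\<lambda>n. n - k"]) auto
  from summable_on_reindex_bij_betw[OF this, of "\<lambda>n. (cmod (x n))\<^sup>2"] assms
  show ?thesis by simp
qed

instantiation ell2 :: real_vector
begin

definition zero_ell2_def: "0 = Abs_ell2 (\<lambda>n. 0)"
definition plus_ell2_def: "x + y = Abs_ell2 (\<lambda>n. ell2_nth x n + ell2_nth y n)"
definition minus_ell2_def: "x - y = Abs_ell2 (\<lambda>n. ell2_nth x n - ell2_nth y n)"
definition uminus_ell2_def: "- x = Abs_ell2 (\<lambda>n. - ell2_nth x n)"
definition scaleR_ell2_def: "r *\<^sub>R x = Abs_ell2 (\<lambda>n. r *\<^sub>R ell2_nth x n)"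

lemma ell2_nth_zero [simp]: "ell2_nth 0 n = 0"
  by (simp add: zero_ell2_def ell2_nth_Abs)

lemma ell2_nth_add [simp]: "ell2_nth (x + y) n = ell2_nth x n + ell2_nth y n"
  by (simp add: plus_ell2_def ell2_nth_Abs square_summable_add ell2_nth_square_summable)

lemma ell2_nth_uminus [simp]: "ell2_nth (- x) n = - ell2_nth x n"
  by (simp add: uminus_ell2_def ell2_nth_Abs ell2_nth_square_summable)

lemma ell2_nth_minus [simp]: "ell2_nth (x - y) n = ell2_nth x n - ell2_nth y n"
  using square_summable_add[OF ell2_nth_square_summable[of x] ell2_nth_square_summable[of "- y"]]
  by (simp add: minus_ell2_def ell2_nth_Abs)

lemma ell2_nth_scaleR [simp]: "ell2_nth (r *\<^sub>R x) n = r *\<^sub>R ell2_nth x n"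
  using square_summable_mult_bounded[OF ell2_nth_square_summable[of x],
      of "\<lambda>_. complex_of_real r" "\<bar>r\<bar>"]
  by (simp add: scaleR_ell2_def ell2_nth_Abs scaleR_conv_of_real)

instance
  by standard (auto intro!: ell2_eqI simp: algebra_simps)

end

definition cscale :: "complex \<Rightarrow> ell2 \<Rightarrow> ell2" where
  "cscale c x = Abs_ell2 (\<lambda>n. c * ell2_nth x n)"

lemma ell2_nth_cscale [simp]: "ell2_nth (cscale c x) n = c * ell2_nth x n"
  using square_summable_mult_bounded[OF ell2_nth_square_summable[of x], of "\<lambda>_. c" "cmod c"]
  by (simp add: cscale_def ell2_nth_Abs)

definition cinner :: "ell2 \<Rightarrow> ell2 \<Rightarrow> complex" where
  "cinner x y = (\<Sum>\<^sub>\<infinity>n. cnj (ell2_nth x n) * ell2_nth y n)"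

lemma cinner_abs_summable:
  "(\<lambda>n. norm (cnj (ell2_nth x n) * ell2_nth y n)) summable_on UNIV"
proof (rule summable_on_comparison_test)
  show "(\<lambda>n. (cmod (ell2_nth x n))\<^sup>2 + (cmod (ell2_nth y n))\<^sup>2) summable_on UNIV"
    by (intro summable_on_add ell2_nth_square_summable)
  show "norm (cnj (ell2_nth x n) * ell2_nth y n)
      \<le> (cmod (ell2_nth x n))\<^sup>2 + (cmod (ell2_nth y n))\<^sup>2" for n
  proof -
    have "2 * (cmod (ell2_nth x n) * cmod (ell2_nth y n))
        \<le> (cmod (ell2_nth x n))\<^sup>2 + (cmod (ell2_nth y n))\<^sup>2"
      using sum_squares_bound[of "cmod (ell2_nth x n)" "cmod (ell2_nth y n)"] by simp
    moreover have "0 \<le> cmod (ell2_nth x n) * cmod (ell2_nth y n)" by simp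
    ultimately show ?thesis unfolding norm_mult complex_mod_cnj by linarith
  qed
qed simp

lemma cinner_summable: "(\<lambda>n. cnj (ell2_nth x n) * ell2_nth y n) summable_on UNIV"
  using cinner_abs_summable by (rule abs_summable_summable)

lemma cinner_commute: "cinner x y = cnj (cinner y x)"
  by (simp add: cinner_def flip: infsum_cnj) (simp add: mult.commute)

lemma cinner_add_left: "cinner (x + y) z = cinner x z + cinner y z"
  by (simp add: cinner_def ring_distribs infsum_add cinner_summable)

lemma cinner_cscale_left: "cinner (cscale c x) y = cnj c * cinner x y"
  by (simp add: cinner_def mult.assoc infsum_cmult_right cinner_summable)

lemma cinner_self: "cinner x x = complex_of_real (\<Sum>\<^sub>\<infinity>n. (cmod (ell2_nth x n))\<^sup>2)"
proof -
  have "cinner x x = (\<Sum>\<^sub>\<infinity>n. complex_of_real ((cmod (ell2_nth x n))\<^sup>2))"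
    by (simp add: cinner_def complex_norm_square mult.commute del: of_real_power)
  then show ?thesis
    using has_sum_bounded_linear[OF bounded_linear_of_real
        has_sum_infsum[OF ell2_nth_square_summable[of x]]]
    by (metis infsumI)
qed

instantiation ell2 :: real_inner
begin

definition inner_ell2_def: "inner x y = Re (cinner x y)"
definition norm_ell2_def: "norm x = sqrt (\<Sum>\<^sub>\<infinity>n. (cmod (ell2_nth x n))\<^sup>2)"
definition sgn_ell2_def: "sgn x = x /\<^sub>R norm (x :: ell2)"
definition dist_ell2_def: "dist x y = norm (x - y :: ell2)"
definition uniformity_ell2_def:
  "(uniformity :: (ell2 \<times> ell2) filter) = (INF e\<in>{0 <..}. principal {(x, y). dist x y < e})"
definition open_ell2_def:
  "open (U :: ell2 set) \<longleftrightarrow> (\<forall>x\<in>U. \<forall>\<^sub>F (x', y) in uniformity. x' = x \<longrightarrow> y \<in> U)"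

instance
proof
  fix x y z :: ell2 and r :: real
  show "dist x y = norm (x - y)" by (rule dist_ell2_def)
  show "sgn x = x /\<^sub>R norm x" by (rule sgn_ell2_def)
  show "uniformity = (INF e\<in>{0 <..}. principal {(x :: ell2, y). dist x y < e})"
    by (rule uniformity_ell2_def)
  show "open U \<longleftrightarrow> (\<forall>x\<in>U. \<forall>\<^sub>F (x', y) in uniformity. x' = x \<longrightarrow> y \<in> U)" for U :: "ell2 set"
    by (rule open_ell2_def)
  show "inner x y = inner y x"
    by (subst (1) inner_ell2_def, subst cinner_commute) (simp add: inner_ell2_def)
  show "inner (x + y) z = inner x z + inner y z"
    by (simp add: inner_ell2_def cinner_add_left)
  have "r *\<^sub>R x = cscale (complex_of_real r) x"
    by (rule ell2_eqI) (simp add: scaleR_conv_of_real)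
  then show "inner (r *\<^sub>R x) y = r * inner x y"
    by (simp add: inner_ell2_def cinner_cscale_left)
  show "0 \<le> inner x x"
    by (simp add: inner_ell2_def cinner_self infsum_nonneg)
  show "inner x x = 0 \<longleftrightarrow> x = 0"
  proof
    assume "inner x x = 0"
    then have "(\<Sum>\<^sub>\<infinity>n. (cmod (ell2_nth x n))\<^sup>2) = 0"
      by (simp add: inner_ell2_def cinner_self)
    then have "(cmod (ell2_nth x n))\<^sup>2 = 0" for n
      using nonneg_infsum_le_0D[of "\<lambda>n. (cmod (ell2_nth x n))\<^sup>2" UNIV n]
      by (simp add: ell2_nth_square_summable)
    then show "x = 0" by (auto intro: ell2_eqI)
  qed (simp add: inner_ell2_def cinner_self)
  show "norm x = sqrt (inner x x)"
    by (simp add: norm_ell2_def inner_ell2_def cinner_self)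
qed

end

lemma norm_ell2_square: "(norm x)\<^sup>2 = (\<Sum>\<^sub>\<infinity>n. (cmod (ell2_nth x n))\<^sup>2)"
  by (simp add: norm_ell2_def infsum_nonneg)

lemma sum_ell2_nth_le_norm:
  assumes "finite A"
  shows "(\<Sum>n\<in>A. (cmod (ell2_nth x n))\<^sup>2) \<le> (norm x)\<^sup>2"
  unfolding norm_ell2_square
  using assms by (intro finite_sum_le_infsum ell2_nth_square_summable) auto

lemma norm_ell2_nth_le: "cmod (ell2_nth x n) \<le> norm x"
  by (rule power2_le_imp_le) (use sum_ell2_nth_le_norm[of "{n}" x] in auto)

instance ell2 :: banach
proof
  fix X :: "nat \<Rightarrow> ell2"
  assume X: "Cauchy X"
  have "Cauchy (\<lambda>k. ell2_nth (X k) n)" for n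
  proof (rule metric_CauchyI)
    fix e :: real assume "0 < e"
    then obtain N where N: "\<And>j k. j \<ge> N \<Longrightarrow> k \<ge> N \<Longrightarrow> dist (X j) (X k) < e"
      using metric_CauchyD[OF X] by blast
    have "dist (ell2_nth (X j) n) (ell2_nth (X k) n) \<le> dist (X j) (X k)" for j k
      using norm_ell2_nth_le[of "X j - X k" n] by (simp add: dist_norm)
    then show "\<exists>N. \<forall>j\<ge>N. \<forall>k\<ge>N. dist (ell2_nth (X j) n) (ell2_nth (X k) n) < e"
      using N by (meson le_less_trans)
  qed
  then have "\<forall>n. \<exists>l. (\<lambda>k. ell2_nth (X k) n) \<longlonglongrightarrow> l"
    by (simp add: Cauchy_convergent_iff convergent_def)
  then obtain l where l: "\<And>n. (\<lambda>k. ell2_nth (X k) n) \<longlonglongrightarrow> l n"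
    by metis
  have tail: "\<exists>N. \<forall>j\<ge>N. (\<lambda>n. (cmod (ell2_nth (X j) n - l n))\<^sup>2) summable_on UNIV
      \<and> (\<Sum>\<^sub>\<infinity>n. (cmod (ell2_nth (X j) n - l n))\<^sup>2) \<le> e\<^sup>2" if "0 < e" for e :: real
  proof -
    obtain N where N: "\<And>j k. j \<ge> N \<Longrightarrow> k \<ge> N \<Longrightarrow> dist (X j) (X k) < e"
      using metric_CauchyD[OF X \<open>0 < e\<close>] by blast
    have fin: "(\<Sum>n\<in>A. (cmod (ell2_nth (X j) n - l n))\<^sup>2) \<le> e\<^sup>2"
      if "finite A" "j \<ge> N" for A j
    proof (rule tendsto_upperbound)
      show "(\<lambda>k. \<Sum>n\<in>A. (cmod (ell2_nth (X j) n - ell2_nth (X k) n))\<^sup>2)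
          \<longlonglongrightarrow> (\<Sum>n\<in>A. (cmod (ell2_nth (X j) n - l n))\<^sup>2)"
        by (intro tendsto_intros l)
      show "\<forall>\<^sub>F k in sequentially.
          (\<Sum>n\<in>A. (cmod (ell2_nth (X j) n - ell2_nth (X k) n))\<^sup>2) \<le> e\<^sup>2"
        using eventually_ge_at_top[of N]
      proof eventually_elim
        case (elim k)
        have "(\<Sum>n\<in>A. (cmod (ell2_nth (X j) n - ell2_nth (X k) n))\<^sup>2) \<le> (norm (X j - X k))\<^sup>2"
          using sum_ell2_nth_le_norm[OF \<open>finite A\<close>, of "X j - X k"] by simp
        also have "\<dots> \<le> e\<^sup>2"
          using N[OF \<open>j \<ge> N\<close> elim] by (intro power_mono) (auto simp: dist_norm)
        finally show ?case .
      qed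
    qed simp
    show ?thesis
    proof (intro exI[of _ N] allI impI conjI)
      fix j assume "j \<ge> N"
      show s: "(\<lambda>n. (cmod (ell2_nth (X j) n - l n))\<^sup>2) summable_on UNIV"
        by (rule nonneg_bdd_above_summable_on)
          (auto intro!: bdd_aboveI[of _ "e\<^sup>2"] fin \<open>j \<ge> N\<close>)
      show "(\<Sum>\<^sub>\<infinity>n. (cmod (ell2_nth (X j) n - l n))\<^sup>2) \<le> e\<^sup>2"
        by (rule infsum_le_finite_sums[OF s]) (auto intro: fin \<open>j \<ge> N\<close>)
    qed
  qed
  obtain j where "(\<lambda>n. (cmod (ell2_nth (X j) n - l n))\<^sup>2) summable_on UNIV"
    using tail[of 1] by auto
  then have "(\<lambda>n. (cmod (- ell2_nth (X j) n + (ell2_nth (X j) n - l n)))\<^sup>2) summable_on UNIV"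
    using ell2_nth_square_summable[of "- X j"] by (intro square_summable_add) simp_all
  then have L: "ell2_nth (Abs_ell2 l) = l"
    by (intro ell2_nth_Abs) simp
  have "X \<longlonglongrightarrow> Abs_ell2 l"
  proof (rule metric_LIMSEQ_I)
    fix e :: real assume "0 < e"
    then obtain N where "\<forall>j\<ge>N. (\<Sum>\<^sub>\<infinity>n. (cmod (ell2_nth (X j) n - l n))\<^sup>2) \<le> (e / 2)\<^sup>2"
      using tail[of "e / 2"] by auto
    then have "\<forall>j\<ge>N. (dist (X j) (Abs_ell2 l))\<^sup>2 \<le> (e / 2)\<^sup>2"
      by (simp add: dist_norm norm_ell2_square L)
    then have "\<forall>j\<ge>N. dist (X j) (Abs_ell2 l) \<le> e / 2"
      using \<open>0 < e\<close> by (auto intro: power2_le_imp_le)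
    then show "\<exists>N. \<forall>j\<ge>N. dist (X j) (Abs_ell2 l) < e"
      using \<open>0 < e\<close> by (intro exI[of _ N]) force
  qed
  then show "convergent X" by (auto simp: convergent_def)
qed

definition ell2_basis :: "int \<Rightarrow> ell2" where
  "ell2_basis k = Abs_ell2 (\<lambda>n. if n = k then 1 else 0)"

lemma ell2_nth_basis [simp]: "ell2_nth (ell2_basis k) n = (if n = k then 1 else 0)"
proof -
  have "(\<lambda>n. (cmod (if n = k then 1 else 0))\<^sup>2) summable_on {k}" by simp
  then have "(\<lambda>n. (cmod (if n = k then 1 else 0))\<^sup>2) summable_on UNIV"
    by (rule summable_on_cong_neutral[THEN iffD1, rotated -1]) auto
  then show ?thesis by (simp add: ell2_basis_def ell2_nth_Abs)
qed

section \<open>Bounded operators and continuous functional calculus\<close>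

lemma bounded_linear_cscale: "bounded_linear (cscale c)"
proof (rule bounded_linear_intro)
  show "norm (cscale c x) \<le> norm x * cmod c" for x
  proof (rule power2_le_imp_le)
    show "(norm (cscale c x))\<^sup>2 \<le> (norm x * cmod c)\<^sup>2"
      by (simp add: norm_ell2_square norm_mult power_mult_distrib infsum_cmult_right'
          mult.commute)
  qed simp
qed (auto intro!: ell2_eqI simp: algebra_simps)

text \<open>
  The type \<open>ell2 \<Rightarrow>\<^sub>L ell2\<close> consists of the bounded real-linear operators. A bounded two-sided
  inverse of a complex-linear operator is automatically complex-linear, so for such operators
  this is the usual spectrum.
\<close>

definition spectrum :: "(ell2 \<Rightarrow>\<^sub>L ell2) \<Rightarrow> complex set" where
  "spectrum A = {z. \<not> (\<exists>B. B o\<^sub>L (A - Blinfun (cscale z)) = id_blinfun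
                          \<and> (A - Blinfun (cscale z)) o\<^sub>L B = id_blinfun)}"

definition poly_op :: "real poly \<Rightarrow> (ell2 \<Rightarrow>\<^sub>L ell2) \<Rightarrow> (ell2 \<Rightarrow>\<^sub>L ell2)" where
  "poly_op p A = (\<Sum>i\<le>degree p. coeff p i *\<^sub>R (((o\<^sub>L) A ^^ i) id_blinfun))"

text \<open>
  Continuous functional calculus of a bounded self-adjoint operator: \<open>g(A)\<close> is the limit, in
  operator norm, of \<open>p\<^sub>n(A)\<close> for real polynomials \<open>p\<^sub>n\<close> converging to \<open>g\<close> uniformly on the
  (real) spectrum of \<open>A\<close>. For self-adjoint \<open>A\<close> the limit exists and does not depend on the
  approximating polynomials.
\<close>

definition fun_calc :: "(real \<Rightarrow> real) \<Rightarrow> (ell2 \<Rightarrow>\<^sub>L ell2) \<Rightarrow> (ell2 \<Rightarrow>\<^sub>L ell2)" where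
  "fun_calc g A = (THE B. \<exists>p. uniform_limit {x. complex_of_real x \<in> spectrum A}
                                (\<lambda>n. poly (p n)) g sequentially
                            \<and> (\<lambda>n. poly_op (p n) A) \<longlonglongrightarrow> B)"

section \<open>Discrete Schroedinger operators\<close>

definition schroedinger :: "(int \<Rightarrow> real) \<Rightarrow> (ell2 \<Rightarrow>\<^sub>L ell2)" where
  "schroedinger v = Blinfun (\<lambda>u. Abs_ell2 (\<lambda>n.
     ell2_nth u (n - 1) + ell2_nth u (n + 1) + complex_of_real (v n) * ell2_nth u n))"

lemma norm_shift_ell2:
  "\<exists>w. ell2_nth w = (\<lambda>n. ell2_nth u (n + k)) \<and> norm w = norm u"
proof -
  have w: "ell2_nth (Abs_ell2 (\<lambda>n. ell2_nth u (n + k))) = (\<lambda>n. ell2_nth u (n + k))"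
    by (intro ell2_nth_Abs square_summable_shift ell2_nth_square_summable)
  have "bij_betw (\<lambda>n::int. n + k) UNIV UNIV"
    by (rule bij_betw_byWitness[where f' = "\<lambda>n. n - k"]) auto
  from infsum_reindex_bij_betw[OF this, of "\<lambda>n. (cmod (ell2_nth u n))\<^sup>2"]
  have "norm (Abs_ell2 (\<lambda>n. ell2_nth u (n + k))) = norm u"
    by (simp add: norm_ell2_def w)
  with w show ?thesis by blast
qed

lemma schroedinger_apply:
  assumes "\<And>n. \<bar>v n\<bar> \<le> C"
  shows "ell2_nth (blinfun_apply (schroedinger v) u) n
       = ell2_nth u (n - 1) + ell2_nth u (n + 1) + complex_of_real (v n) * ell2_nth u n"
proof -
  define h where "h u = (\<lambda>n. ell2_nth u (n - 1) + ell2_nth u (n + 1)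
      + complex_of_real (v n) * ell2_nth u n)" for u
  have v: "cmod (complex_of_real (v n)) \<le> C" for n using assms by simp
  have nth: "ell2_nth (Abs_ell2 (h u)) = h u" for u
    unfolding h_def
    using square_summable_shift[OF ell2_nth_square_summable[of u], of "-1"]
      square_summable_shift[OF ell2_nth_square_summable[of u], of 1]
      square_summable_mult_bounded[OF ell2_nth_square_summable[of u] v]
    by (intro ell2_nth_Abs square_summable_add) simp_all
  have "bounded_linear (\<lambda>u. Abs_ell2 (h u))"
  proof (rule bounded_linear_intro)
    show "Abs_ell2 (h (x + y)) = Abs_ell2 (h x) + Abs_ell2 (h y)" for x y
      by (rule ell2_eqI) (simp add: nth, simp add: h_def algebra_simps)
    show "Abs_ell2 (h (r *\<^sub>R x)) = r *\<^sub>R Abs_ell2 (h x)" for r x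
      by (rule ell2_eqI) (simp add: nth, simp add: h_def algebra_simps)
    fix u
    obtain w1 where w1: "ell2_nth w1 = (\<lambda>n. ell2_nth u (n + -1))" "norm w1 = norm u"
      using norm_shift_ell2 by blast
    obtain w2 where w2: "ell2_nth w2 = (\<lambda>n. ell2_nth u (n + 1))" "norm w2 = norm u"
      using norm_shift_ell2 by blast
    define w3 where "w3 = Abs_ell2 (\<lambda>n. complex_of_real (v n) * ell2_nth u n)"
    have w3: "ell2_nth w3 = (\<lambda>n. complex_of_real (v n) * ell2_nth u n)"
      unfolding w3_def
      by (intro ell2_nth_Abs square_summable_mult_bounded[OF ell2_nth_square_summable v])
    have C: "0 \<le> C" using assms[of 0] by linarith
    have "norm w3 \<le> C * norm u"
    proof (rule power2_le_imp_le)
      have "(norm w3)\<^sup>2 \<le> (\<Sum>\<^sub>\<infinity>n. C\<^sup>2 * (cmod (ell2_nth u n))\<^sup>2)"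
        unfolding norm_ell2_square
      proof (rule infsum_mono)
        show "(\<lambda>n. C\<^sup>2 * (cmod (ell2_nth u n))\<^sup>2) summable_on UNIV"
          by (intro summable_on_cmult_right ell2_nth_square_summable)
        show "(cmod (ell2_nth w3 n))\<^sup>2 \<le> C\<^sup>2 * (cmod (ell2_nth u n))\<^sup>2" for n
        proof -
          have "(v n)\<^sup>2 \<le> C\<^sup>2" using assms[of n] C by (simp flip: abs_le_square_iff)
          then show ?thesis by (simp add: w3 norm_mult power_mult_distrib mult_right_mono)
        qed
      qed (rule ell2_nth_square_summable)
      then show "(norm w3)\<^sup>2 \<le> (C * norm u)\<^sup>2"
        by (simp add: infsum_cmult_right' norm_ell2_square power_mult_distrib)
    qed (simp add: C)
    moreover have "Abs_ell2 (h u) = w1 + w2 + w3"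
      by (rule ell2_eqI) (simp add: nth, simp add: h_def w1 w2 w3)
    ultimately show "norm (Abs_ell2 (h u)) \<le> norm u * (2 + C)"
      using norm_triangle_ineq[of "w1 + w2" w3] norm_triangle_ineq[of w1 w2] w1(2) w2(2)
      by (simp add: algebra_simps)
  qed
  then have "blinfun_apply (schroedinger v) u = Abs_ell2 (h u)"
    by (simp add: schroedinger_def bounded_linear_Blinfun_apply flip: h_def)
  then show ?thesis by (simp add: nth) (simp add: h_def)
qed

lemma schroedinger_cscale:
  assumes "\<And>n. \<bar>v n\<bar> \<le> C"
  shows "blinfun_apply (schroedinger v) (cscale c u) = cscale c (blinfun_apply (schroedinger v) u)"
  by (rule ell2_eqI) (simp add: schroedinger_apply[OF assms] algebra_simps)

lemma schroedinger_self_adjoint: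
  assumes "\<And>n. \<bar>v n\<bar> \<le> C"
  shows "cinner (blinfun_apply (schroedinger v) x) y = cinner x (blinfun_apply (schroedinger v) y)"
proof -
  define a b where "a n = cnj (ell2_nth x (n - 1)) * ell2_nth y n"
    and "b n = cnj (ell2_nth x (n + 1)) * ell2_nth y n" for n
  obtain w1 where w1: "ell2_nth w1 = (\<lambda>n. ell2_nth x (n + -1))" using norm_shift_ell2 by blast
  obtain w2 where w2: "ell2_nth w2 = (\<lambda>n. ell2_nth x (n + 1))" using norm_shift_ell2 by blast
  have a: "a summable_on UNIV"
    using cinner_summable[of w1 y] by (simp add: w1 a_def[abs_def])
  have b: "b summable_on UNIV"
    using cinner_summable[of w2 y] by (simp add: w2 b_def[abs_def])
  have bij: "bij (\<lambda>n::int. n + k)" for k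
    by (rule bij_betw_byWitness[where f' = "\<lambda>n. n - k"]) auto
  have a': "(\<lambda>n. a (n + 1)) summable_on UNIV" "(\<Sum>\<^sub>\<infinity>n. a (n + 1)) = infsum a UNIV"
    using summable_on_reindex_bij_betw[OF bij, of a] infsum_reindex_bij_betw[OF bij, of a] a
    by auto
  have b': "(\<lambda>n. b (n + -1)) summable_on UNIV" "(\<Sum>\<^sub>\<infinity>n. b (n + -1)) = infsum b UNIV"
    using summable_on_reindex_bij_betw[OF bij[of "-1"], of b]
      infsum_reindex_bij_betw[OF bij[of "-1"], of b] b
    by auto
  define d where "d n = complex_of_real (v n) * (cnj (ell2_nth x n) * ell2_nth y n)" for n
  have L: "cnj (ell2_nth (blinfun_apply (schroedinger v) x) n) * ell2_nth y n = a n + b n + d n"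
    for n by (simp add: schroedinger_apply[OF assms] a_def b_def d_def algebra_simps)
  have R: "cnj (ell2_nth x n) * ell2_nth (blinfun_apply (schroedinger v) y) n
      = a (n + 1) + b (n + -1) + d n"
    for n by (simp add: schroedinger_apply[OF assms] a_def b_def d_def algebra_simps)
  have "ell2_nth (Abs_ell2 (\<lambda>n. complex_of_real (v n) * ell2_nth x n))
      = (\<lambda>n. complex_of_real (v n) * ell2_nth x n)"
    by (intro ell2_nth_Abs square_summable_mult_bounded[OF ell2_nth_square_summable, of _ C])
      (simp add: assms)
  with cinner_summable[of "Abs_ell2 (\<lambda>n. complex_of_real (v n) * ell2_nth x n)" y]
  have d: "d summable_on UNIV" by (simp add: d_def[abs_def] mult.assoc)
  have "(\<Sum>\<^sub>\<infinity>n. a n + b n + d n) = infsum a UNIV + infsum b UNIV + infsum d UNIV"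
    using infsum_add[OF summable_on_add[OF a b] d] infsum_add[OF a b] by simp
  moreover have "(\<Sum>\<^sub>\<infinity>n. a (n + 1) + b (n + -1) + d n)
      = infsum a UNIV + infsum b UNIV + infsum d UNIV"
    using infsum_add[OF summable_on_add[OF a'(1) b'(1)] d] infsum_add[OF a'(1) b'(1)] a'(2) b'(2)
    by simp
  ultimately show ?thesis
    unfolding cinner_def L R by simp
qed

section \<open>Transformations of a measure space\<close>

definition invertible_transformation :: "'a measure \<Rightarrow> ('a \<Rightarrow> 'a) \<Rightarrow> bool" where
  "invertible_transformation M T \<longleftrightarrow> T \<in> measurable M M \<and> bij_betw T (space M) (space M)
     \<and> the_inv_into (space M) T \<in> measurable M M"

definition measure_preserving_transformation :: "'a measure \<Rightarrow> ('a \<Rightarrow> 'a) \<Rightarrow> bool" where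
  "measure_preserving_transformation M T \<longleftrightarrow> T \<in> measurable M M
     \<and> (\<forall>E\<in>sets M. emeasure M (T -` E \<inter> space M) = emeasure M E)"

definition ergodic_transformation :: "'a measure \<Rightarrow> ('a \<Rightarrow> 'a) \<Rightarrow> bool" where
  "ergodic_transformation M T \<longleftrightarrow> T \<in> measurable M M
     \<and> (\<forall>E\<in>sets M. T -` E \<inter> space M = E \<longrightarrow> emeasure M E = 0 \<or> emeasure M (space M - E) = 0)"

definition conservative_transformation :: "'a measure \<Rightarrow> ('a \<Rightarrow> 'a) \<Rightarrow> bool" where
  "conservative_transformation M T \<longleftrightarrow> T \<in> measurable M M
     \<and> \<not> (\<exists>W\<in>sets M. emeasure M W > 0 \<and> disjoint_family (\<lambda>n::nat. (T ^^ n) -` W \<inter> space M))"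

definition int_iterate :: "'a set \<Rightarrow> ('a \<Rightarrow> 'a) \<Rightarrow> int \<Rightarrow> 'a \<Rightarrow> 'a" where
  "int_iterate \<Omega> T n = (if 0 \<le> n then T ^^ nat n else the_inv_into \<Omega> T ^^ nat (- n))"

definition orbit_operator ::
  "'a measure \<Rightarrow> ('a \<Rightarrow> 'a) \<Rightarrow> ('a \<Rightarrow> real) \<Rightarrow> 'a \<Rightarrow> (ell2 \<Rightarrow>\<^sub>L ell2)" where
  "orbit_operator M T f \<omega> = schroedinger (\<lambda>n. f (int_iterate (space M) T n \<omega>))"

section \<open>Weak convergence of measures on the real line\<close>

definition weakly_converges :: "(nat \<Rightarrow> real measure) \<Rightarrow> real measure \<Rightarrow> bool" where
  "weakly_converges \<kappa> \<nu> \<longleftrightarrow>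
     (\<forall>g :: real \<Rightarrow> real. continuous_on UNIV g \<and> bounded (range g) \<longrightarrow>
        (\<lambda>l. LINT x|\<kappa> l. g x) \<longlonglongrightarrow> (LINT x|\<nu>. g x))"

end

theory Submission
  imports "HOL-Computational_Algebra.Fundamental_Theorem_Algebra" Defs
begin

text \<open>
  The first moment of \<open>dk\<^sup>l\<close> is the average of \<open>f\<close> over \<open>F\<^sub>l\<close>, because
  \<open>\<langle>\<delta>\<^sub>0, H\<^sub>\<omega> \<delta>\<^sub>0\<rangle> = f(\<omega>)\<close> and the supports of the measures are uniformly bounded. So it suffices that
  \<open>f\<close> is the indicator of a set which, like its complement, has infinite measure: an exhaustion that
  alternately adds much more of the set and much more of the complement makes these averages oscillate.
  Any infinite-measure system will do. We take a tower with non-integrable height function over an irrational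
  rotation; realised inside the real line, the transformation is a piecewise translation.
  The measures \<open>dk\<^sup>l\<close> exist since \<open>p \<mapsto> \<langle>\<delta>\<^sub>0, p(H\<^sub>\<omega>) \<delta>\<^sub>0\<rangle>\<close> is nonnegative on Bernstein polynomials.
\<close>

section \<open>Piecewise translations and dense groups of translations\<close>

text \<open>The heights come from the harmonic series: for \<open>k \<ge> 1\<close>, level
  \<open>k\<close> lies above the base points \<open>0 < x \<le> 1 / k\<close>, so the even levels
  and the odd levels each have infinite total length, and the indicator of the even levels can serve
  as \<open>f\<close>. Storing the level as integer part and the base point as \<open>frac\<close>
  turns an invariant set of the tower into a set of reals invariant under translation by 1 and by
  \<alpha>, so ergodicity becomes a statement about dense translations of the line. The analytic
  obstacle is that \<open>fun_calc\<close> is a definite description: before it can be evaluated,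
  the norm of \<open>p(A)\<close> must be bounded by the supremum of \<open>\<bar>p\<bar>\<close>
  over the real spectrum of \<open>A\<close>. In place of the spectral theorem, real polynomials are
  factored and lower bounds \<open>c * norm u \<le> norm (A u)\<close> are tracked. The identity
  function is unbounded and so is no test function for weak convergence; as all operator norms are
  at most 3, the first moment is tested with the identity truncated at -3 and 3.\<close>

lemma emeasure_lborel_translation:
  fixes E :: "real set"
  assumes "E \<in> sets borel"
  shows "emeasure lborel ((\<lambda>y. y + d) -` E) = emeasure lborel E"
proof -
  have "emeasure lborel E = emeasure (distr lborel borel ((+) d)) E"
    by (simp add: lborel_distr_plus)
  also have "\<dots> = emeasure lborel ((\<lambda>y. y + d) -` E)"
    using assms by (subst emeasure_distr) (simp_all add: vimage_def add.commute)
  finally show ?thesis by simp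
qed

text \<open>Sorting points by their displacement \<open>T y - y\<close> splits the preimage of
  \<open>E\<close> into countably many pieces, and \<open>T\<close> moves each one rigidly. By
  injectivity the moved pieces are still disjoint, and by surjectivity they fill
  \<open>E\<close>.\<close>

lemma emeasure_piecewise_translation:
  fixes T :: "real \<Rightarrow> real"
  assumes T: "T \<in> borel_measurable borel" "bij_betw T \<Omega> \<Omega>" and \<Omega>: "\<Omega> \<in> sets borel"
    and D: "countable D" "\<And>y. y \<in> \<Omega> \<Longrightarrow> T y - y \<in> D" and E: "E \<in> sets borel" "E \<subseteq> \<Omega>"
  shows "emeasure lborel (T -` E \<inter> \<Omega>) = emeasure lborel E"
proof -
  define P where "P d = {y \<in> \<Omega>. T y \<in> E \<and> T y = y + d}" for d
  define Q where "Q d = (\<lambda>y. y + (- d)) -` P d" for d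
  have [measurable]: "T \<in> borel_measurable borel" "E \<in> sets borel" "\<Omega> \<in> sets borel"
    using T E \<Omega> by auto
  have P: "P d \<in> sets borel" for d
    unfolding P_def by measurable
  have Q: "Q d \<in> sets borel" for d
    unfolding Q_def using measurable_sets[OF _ P[of d], of "\<lambda>y. y + (- d)" borel] by simp
  have disj: "P c \<inter> P d = {}" if "c \<noteq> d" for c d
  proof -
    have False if "y \<in> P c" "y \<in> P d" for y
    proof -
      from that have "y + c = y + d" unfolding P_def by (metis (mono_tags, lifting) mem_Collect_eq)
      with \<open>c \<noteq> d\<close> show False by simp
    qed
    then show ?thesis by blast
  qed
  have inj: "inj_on T \<Omega>" and im: "T ` \<Omega> = \<Omega>" using T(2) by (auto simp: bij_betw_def)
  have Q_eq: "Q d = T ` P d" for d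
  proof -
    have "z \<in> T ` P d" if "z \<in> Q d" for z
    proof -
      from that have "z - d \<in> P d" "T (z - d) = z" by (auto simp: Q_def P_def)
      then show ?thesis by (metis imageI)
    qed
    then show ?thesis by (auto simp: Q_def P_def)
  qed
  have "emeasure lborel (T -` E \<inter> \<Omega>) = emeasure lborel (\<Union>d\<in>D. P d)"
    using D(2) by (intro arg_cong[where f = "emeasure lborel"]) (force simp: P_def)
  also have "\<dots> = (\<integral>\<^sup>+d. emeasure lborel (P d) \<partial>count_space D)"
    using P D(1) by (intro emeasure_UN_countable) (auto simp: disjoint_family_on_def disj)
  also have "\<dots> = (\<integral>\<^sup>+d. emeasure lborel (Q d) \<partial>count_space D)"
    unfolding Q_def by (simp only: emeasure_lborel_translation[OF P])
  also have "\<dots> = emeasure lborel (\<Union>d\<in>D. Q d)"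
  proof (rule emeasure_UN_countable[symmetric])
    show "disjoint_family_on Q D"
      unfolding disjoint_family_on_def Q_eq
    proof (intro ballI impI)
      fix c d :: real assume "c \<noteq> d"
      then have "P c \<inter> P d = {}" by (rule disj)
      moreover have "P c \<subseteq> \<Omega>" "P d \<subseteq> \<Omega>" by (auto simp: P_def)
      ultimately show "T ` P c \<inter> T ` P d = {}"
        using inj_on_image_Int[OF inj] by (metis image_empty)
    qed
  qed (use Q D(1) in auto)
  also have "(\<Union>d\<in>D. Q d) = E"
  proof (intro equalityI subsetI)
    fix z assume "z \<in> E"
    then obtain y where y: "y \<in> \<Omega>" "z = T y" using E(2) im by blast
    with \<open>z \<in> E\<close> have "y \<in> P (T y - y)" by (simp add: P_def)
    then have "z \<in> Q (T y - y)" unfolding Q_eq y by (rule imageI)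
    then show "z \<in> (\<Union>d\<in>D. Q d)" using D(2)[OF y(1)] by blast
  qed (auto simp: Q_eq P_def)
  finally show ?thesis .
qed

text \<open>The length of the part of \<open>P\<close> in \<open>(a, b]\<close> is unchanged by a
  dense set of shifts and depends continuously on the endpoints, so it is unchanged by all shifts
  and equals \<open>c * (b - a)\<close>. If \<open>c = 0\<close>, then \<open>P\<close> is null;
  otherwise Lebesgue measure restricted to \<open>P\<close> and divided by \<open>c\<close> is again
  Lebesgue measure, which leaves nothing for the complement.\<close>

lemma translation_invariant_null_or_conull:
  fixes P :: "real set"
  assumes P: "P \<in> sets borel"
    and dense: "\<And>x \<epsilon>. \<epsilon> > 0 \<Longrightarrow> \<exists>g. (\<forall>y. y + g \<in> P \<longleftrightarrow> y \<in> P) \<and> \<bar>g - x\<bar> < \<epsilon>"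
  shows "emeasure lborel P = 0 \<or> emeasure lborel (- P) = 0"
proof -
  define \<phi> where "\<phi> a b = measure lborel (P \<inter> {a<..b})" for a b
  have fin: "emeasure lborel (P \<inter> {a<..b}) < \<infinity>" for a b
  proof -
    have "emeasure lborel (P \<inter> {a<..b}) \<le> emeasure lborel {a..b}"
      by (rule emeasure_mono) auto
    then show ?thesis by (auto simp: emeasure_lborel_Icc_eq intro: le_less_trans)
  qed
  have em: "emeasure lborel (P \<inter> {a<..b}) = \<phi> a b" for a b
    using fin[of a b] by (simp add: \<phi>_def emeasure_eq_ennreal_measure)
  have split: "\<phi> a c = \<phi> a b + \<phi> b c" if "a \<le> b" "b \<le> c" for a b c
  proof -
    have "P \<inter> {a<..c} = (P \<inter> {a<..b}) \<union> (P \<inter> {b<..c})" using that by auto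
    then show ?thesis
      unfolding \<phi>_def using P fin
      by (simp only:) (intro measure_Union, auto simp: less_top)
  qed
  have nonneg: "0 \<le> \<phi> a b" for a b by (simp add: \<phi>_def)
  have small: "\<phi> a b \<le> b - a" if "a \<le> b" for a b
  proof -
    have "\<phi> a b \<le> measure lborel {a<..b}"
      unfolding \<phi>_def using P that by (intro measure_mono_fmeasurable) (auto simp: fmeasurable_def)
    then show ?thesis using that by simp
  qed
  have shift: "\<phi> (a + s) (b + s) = \<phi> a b" if ab: "a \<le> b" for a b s
  proof -
    \<comment> \<open>Shifting by an invariant \<open>g\<close> near \<open>s\<close> instead of by
      \<open>s\<close> alters only two end pieces of length \<open>\<bar>g - s\<bar>\<close>
      each.\<close>
    have "\<bar>\<phi> (a + s) (b + s) - \<phi> a b\<bar> \<le> 2 * \<epsilon>" if "\<epsilon> > 0" for \<epsilon>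
    proof -
      obtain g where g: "\<And>y. y + g \<in> P \<longleftrightarrow> y \<in> P" "\<bar>g - s\<bar> < \<epsilon>"
        using dense[OF \<open>\<epsilon> > 0\<close>] by blast
      have "(\<lambda>y. y + g) -` (P \<inter> {a + g<..b + g}) = P \<inter> {a<..b}" using g(1) by auto
      then have eq: "\<phi> (a + g) (b + g) = \<phi> a b"
        using emeasure_lborel_translation[of "P \<inter> {a + g<..b + g}" g] P em nonneg by simp
      show ?thesis
      proof (cases "s \<le> g")
        case True
        then have "\<phi> (a + s) (b + g) = \<phi> (a + s) (b + s) + \<phi> (b + s) (b + g)"
          "\<phi> (a + s) (b + g) = \<phi> (a + s) (a + g) + \<phi> (a + g) (b + g)"
          using ab by (auto intro!: split)
        moreover have "\<phi> (b + s) (b + g) \<le> g - s" "\<phi> (a + s) (a + g) \<le> g - s"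
          using small[of "b + s" "b + g"] small[of "a + s" "a + g"] True by auto
        ultimately show ?thesis
          using eq g(2) nonneg[of "b + s" "b + g"] nonneg[of "a + s" "a + g"] by linarith
      next
        case False
        then have "\<phi> (a + g) (b + s) = \<phi> (a + g) (b + g) + \<phi> (b + g) (b + s)"
          "\<phi> (a + g) (b + s) = \<phi> (a + g) (a + s) + \<phi> (a + s) (b + s)"
          using ab by (auto intro!: split)
        moreover have "\<phi> (b + g) (b + s) \<le> s - g" "\<phi> (a + g) (a + s) \<le> s - g"
          using small[of "b + g" "b + s"] small[of "a + g" "a + s"] False by auto
        ultimately show ?thesis
          using eq g(2) nonneg[of "b + g" "b + s"] nonneg[of "a + g" "a + s"] by linarith
      qed
    qed
    from this[of "\<bar>\<phi> (a + s) (b + s) - \<phi> a b\<bar> / 4"] show ?thesis by fastforce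
  qed
  define c where "c = \<phi> 0 1"
  have mult: "\<phi> 0 (real k * t) = real k * \<phi> 0 t" if "t \<ge> 0" for k t
  proof (induction k)
    case 0
    show ?case by (simp add: \<phi>_def)
  next
    case (Suc k)
    have "\<phi> 0 (real (Suc k) * t) = \<phi> 0 (real k * t) + \<phi> (0 + real k * t) (t + real k * t)"
      using that split[of 0 "real k * t" "real (Suc k) * t"] by (simp add: algebra_simps)
    also have "\<dots> = real (Suc k) * \<phi> 0 t"
      using Suc that by (subst shift) (auto simp: algebra_simps)
    finally show ?case .
  qed
  have lin: "\<phi> 0 t = c * t" if t: "t \<ge> 0" for t
  proof -
    \<comment> \<open>Rounding \<open>n * t\<close> down to an integer changes each of the two terms
      by at most 1, whatever \<open>n\<close> is; for large \<open>n\<close> this forces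
      equality.\<close>
    have "real n * \<bar>\<phi> 0 t - c * t\<bar> \<le> 2" for n
    proof -
      define k where "k = nat \<lfloor>real n * t\<rfloor>"
      have k: "real k \<le> real n * t" "real n * t < real k + 1"
        using t by (simp_all add: k_def)
      have "\<phi> 0 (real n * t) = \<phi> 0 (real k) + \<phi> (real k) (real n * t)"
        using k by (intro split) auto
      moreover have "\<phi> 0 (real k) = c * real k" using mult[of 1 k] by (simp add: c_def)
      moreover have "\<phi> (real k) (real n * t) \<le> 1" using small[OF k(1)] k by linarith
      moreover have "c * real k \<le> c * (real n * t)" "c * (real n * t) \<le> c * (real k + 1)"
        using k nonneg[of 0 1] by (auto intro!: mult_left_mono simp: c_def)
      moreover have "c \<le> 1" using small[of 0 1] by (simp add: c_def)
      ultimately have "\<bar>\<phi> 0 (real n * t) - c * (real n * t)\<bar> \<le> 2"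
        using nonneg[of "real k" "real n * t"] by (simp add: abs_le_iff algebra_simps)
      then show ?thesis
        using mult[OF t, of n]
        by (metis abs_mult abs_of_nat mult.left_commute right_diff_distrib)
    qed
    then have "\<not> 0 < \<bar>\<phi> 0 t - c * t\<bar>"
      using reals_Archimedean3 by (meson not_less)
    then show ?thesis by simp
  qed
  have val: "\<phi> a b = c * (b - a)" if "a \<le> b" for a b
    using shift[of 0 "b - a" a] lin[of "b - a"] that by simp
  show ?thesis
  proof (cases "c = 0")
    case True
    have "emeasure lborel (\<Union>n::nat. P \<inter> {- real n<..real n}) \<le> 0"
      using P by (intro order_trans[OF emeasure_subadditive_countably])
        (auto simp: em val True)
    moreover have "(\<Union>n::nat. P \<inter> {- real n<..real n}) = P"
    proof -
      have "\<exists>n::nat. - real n < x \<and> x \<le> real n" for x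
      proof -
        obtain n where "\<bar>x\<bar> < real n" using reals_Archimedean2 by blast
        then show ?thesis by (intro exI[of _ n]) linarith
      qed
      then show ?thesis by auto
    qed
    ultimately show ?thesis by simp
  next
    case False
    then have c: "c > 0" using nonneg[of 0 1] by (simp add: c_def)
    define M where "M = density lborel (\<lambda>x. ennreal (1 / c) * indicator P x)"
    have M: "emeasure M A = ennreal (1 / c) * emeasure lborel (P \<inter> A)" if "A \<in> sets borel" for A
      using that P unfolding M_def
      by (subst emeasure_density)
        (auto simp: nn_integral_cmult mult.assoc indicator_inter_arith[symmetric] nn_integral_indicator)
    have "lborel = M"
    proof (rule lborel_eqI)
      fix l u :: real assume "\<And>b. b \<in> Basis \<Longrightarrow> l \<bullet> b \<le> u \<bullet> b"
      then have lu: "l \<le> u" by simp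
      have "emeasure lborel (P \<inter> {l<..<u}) = emeasure lborel (P \<inter> {l<..u})"
      proof (rule emeasure_eq_AE)
        show "AE x in lborel. (x \<in> P \<inter> {l<..<u}) = (x \<in> P \<inter> {l<..u})"
          using AE_lborel_singleton[of u] by eventually_elim auto
      qed (use P in auto)
      also have "\<dots> = ennreal (c * (u - l))" using em val[OF lu] by simp
      finally have "emeasure M {l<..<u} = ennreal (1 / c) * ennreal (c * (u - l))"
        by (simp add: M)
      also have "\<dots> = ennreal (u - l)"
        using c lu by (simp flip: ennreal_mult)
      finally show "emeasure M (box l u) = ennreal (\<Prod>b\<in>Basis. (u - l) \<bullet> b)" by (simp add: box_real)
    qed (simp add: M_def)
    then have "emeasure lborel (- P) = emeasure M (- P)" by simp
    also have "\<dots> = 0" using P by (subst M) auto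
    finally show ?thesis by blast
  qed
qed

text \<open>
  For a wandering set \<open>W\<close> the sets \<open>B \<inter> T\<^sup>-\<^sup>n W\<close> are disjoint, so the measures of the sets \<open>W \<inter> T\<^sup>n B\<close>
  are summable, while every point of \<open>W\<close> lies in infinitely many of them: Borel--Cantelli applies.
\<close>

lemma conservative_if_backward_recurrent:
  assumes mp: "measure_preserving_transformation M T"
    and S: "S \<in> measurable M M" "\<And>y. y \<in> space M \<Longrightarrow> S (T y) = y"
    and B: "B \<in> sets M" "emeasure M B < \<infinity>"
    and rec: "\<And>y. y \<in> space M \<Longrightarrow> \<exists>n. (S ^^ n) y \<in> B"
  shows "conservative_transformation M T"
proof -
  have T: "T \<in> measurable M M"
    using mp by (simp add: measure_preserving_transformation_def)
  have Tn: "T ^^ n \<in> measurable M M" and Sn: "S ^^ n \<in> measurable M M" for n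
    using T S(1) by (simp_all add: measurable_compose_n)
  have TE: "emeasure M ((T ^^ n) -` E \<inter> space M) = emeasure M E" if "E \<in> sets M" for n E
    using that
  proof (induction n arbitrary: E)
    case 0
    then show ?case using sets.sets_into_space by (simp add: Int_absorb2)
  next
    case (Suc n)
    have "(T ^^ Suc n) -` E \<inter> space M = (T ^^ n) -` (T -` E \<inter> space M) \<inter> space M"
      using measurable_space[OF Tn[of n]] by auto
    moreover have "emeasure M (T -` E \<inter> space M) = emeasure M E"
      using mp Suc.prems by (simp add: measure_preserving_transformation_def)
    ultimately show ?case
      using Suc.IH[OF measurable_sets[OF T Suc.prems]] by presburger
  qed
  have ST: "(S ^^ n) ((T ^^ n) y) = y" if "y \<in> space M" for n y
  proof (induction n)
    case (Suc n)
    have "(S ^^ Suc n) ((T ^^ Suc n) y) = (S ^^ n) (S (T ((T ^^ n) y)))"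
      by (simp add: funpow_swap1)
    also have "S (T ((T ^^ n) y)) = (T ^^ n) y"
      by (rule S(2)) (rule measurable_space[OF Tn that])
    finally show ?case using Suc by simp
  qed simp
  have "emeasure M W = 0"
    if W: "W \<in> sets M" "disjoint_family (\<lambda>n::nat. (T ^^ n) -` W \<inter> space M)" for W
  proof -
    define A where "A n = W \<inter> ((S ^^ n) -` B \<inter> space M)" for n
    define C where "C n = B \<inter> ((T ^^ n) -` W \<inter> space M)" for n
    have A_sets: "A n \<in> sets M" and C_sets: "C n \<in> sets M" for n
      using W(1) B(1) Tn Sn by (auto simp: A_def C_def)
    have "(T ^^ n) -` A n \<inter> space M = C n" for n
      using measurable_space[OF Tn] ST by (auto simp: A_def C_def)
    then have AC: "emeasure M (A n) = emeasure M (C n)" for n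
      using TE[OF A_sets, of n n] by simp
    have C_le: "emeasure M C' < \<infinity>" if "C' \<subseteq> B" for C'
      using emeasure_mono[OF that B(1)] B(2) by (rule le_less_trans)
    have "emeasure M (\<Union>n. C n) \<noteq> \<infinity>"
      using C_le[of "\<Union>n. C n"] by (auto simp: C_def)
    moreover have "disjoint_family C"
      using W(2) by (auto simp: disjoint_family_on_def C_def)
    ultimately have "summable (\<lambda>n. measure M (C n))"
      using measure_UNION[of C M] C_sets by (auto simp: sums_iff)
    then have "summable (\<lambda>n. measure M (A n))" by (simp add: measure_def AC)
    moreover have "emeasure M (A n) < \<infinity>" for n
      unfolding AC by (rule C_le) (auto simp: C_def)
    ultimately have "limsup A \<in> null_sets M"
      using A_sets by (intro borel_cantelli_limsup1)
    moreover have "W \<subseteq> limsup A"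
    proof
      fix y assume "y \<in> W"
      have "\<exists>n\<ge>m. y \<in> A n" for m
      proof -
        have y: "y \<in> space M" using \<open>y \<in> W\<close> W(1) sets.sets_into_space by blast
        then obtain n where "(S ^^ n) ((S ^^ m) y) \<in> B"
          using rec[of "(S ^^ m) y"] measurable_space[OF Sn] by blast
        then show ?thesis
          using y \<open>y \<in> W\<close> by (intro exI[of _ "n + m"]) (simp add: A_def funpow_add)
      qed
      then show "y \<in> limsup A" by (auto simp: limsup_INF_SUP)
    qed
    ultimately show ?thesis
      by (metis null_sets_subset W(1) null_setsD1)
  qed
  then show ?thesis
    unfolding conservative_transformation_def using T by (metis less_irrefl)
qed

section \<open>A tower over an irrational rotation\<close>

text \<open>
  The real number \<open>x + k\<close> with \<open>0 \<le> x < 1\<close> represents level \<open>k\<close> above the base point \<open>x\<close>, whose tower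
  has \<open>1 + \<lfloor>1 / x\<rfloor>\<close> levels. The value \<open>1 / 0 = 0\<close> gives the base point \<open>0\<close> a single level.
\<close>

definition tower :: "real set" where
  "tower = {y. 0 \<le> \<lfloor>y\<rfloor> \<and> of_int \<lfloor>y\<rfloor> \<le> 1 / frac y}"

text \<open>The test asks whether the next level still belongs to the tower over
  \<open>frac y\<close>. From the top the point drops to level 0 and its base point is rotated;
  \<open>frac (y + \<alpha>)\<close> does both, because the level is an integer.\<close>

definition tower_map :: "real \<Rightarrow> real \<Rightarrow> real" where
  "tower_map \<alpha> y = (if of_int \<lfloor>y\<rfloor> + 1 \<le> 1 / frac y then y + 1 else frac (y + \<alpha>))"

text \<open>Within the tower exactly the points of level 0 have \<open>z < 1\<close>; such a point
  comes from the top level \<open>\<lfloor>1 / x\<rfloor>\<close> over the base point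
  \<open>x\<close> that the rotation sends to \<open>z\<close>.\<close>

definition tower_map_inv :: "real \<Rightarrow> real \<Rightarrow> real" where
  "tower_map_inv \<alpha> z = (if 1 \<le> z then z - 1 else frac (z - \<alpha>) + of_int \<lfloor>1 / frac (z - \<alpha>)\<rfloor>)"

lemma frac_add_1 [simp]: "frac (y + 1) = frac (y :: real)" "frac (y - 1) = frac (y :: real)"
  by (simp_all add: frac_def)

lemma floor_frac_frac_add_of_int [simp]:
  fixes x :: real
  shows "\<lfloor>frac x + of_int n\<rfloor> = n" "frac (frac x + of_int n) = frac x"
  by (simp_all add: frac_def)

lemma tower_nonneg: "y \<in> tower \<Longrightarrow> 0 \<le> y"
  by (simp add: tower_def)

lemma unit_interval_subset_tower: "{0..<1} \<subseteq> tower"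
proof
  fix x :: real assume "x \<in> {0..<1}"
  then have "0 \<le> x" "\<lfloor>x\<rfloor> = 0" by (simp_all add: floor_eq_iff)
  then show "x \<in> tower" by (simp add: tower_def)
qed

lemma frac_in_tower: "frac (x :: real) \<in> tower"
  using unit_interval_subset_tower by (auto simp: frac_lt_1)

lemma tower_top: "frac x + of_int \<lfloor>1 / frac x\<rfloor> \<in> tower" for x :: real
  by (simp add: tower_def)

lemma tower_minus_1: "y \<in> tower \<Longrightarrow> 1 \<le> y \<Longrightarrow> y - 1 \<in> tower"
  by (auto simp: tower_def le_floor_iff)

lemma tower_map_in_tower: "y \<in> tower \<Longrightarrow> tower_map \<alpha> y \<in> tower"
  by (auto simp: tower_map_def frac_in_tower) (auto simp: tower_def)

lemma tower_map_inv_in_tower: "z \<in> tower \<Longrightarrow> tower_map_inv \<alpha> z \<in> tower"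
  by (auto simp: tower_map_inv_def tower_top tower_minus_1)

lemma tower_map_inv_tower_map:
  assumes "y \<in> tower"
  shows "tower_map_inv \<alpha> (tower_map \<alpha> y) = y"
proof (cases "of_int \<lfloor>y\<rfloor> + 1 \<le> 1 / frac y")
  case True
  then show ?thesis using tower_nonneg[OF assms] by (simp add: tower_map_def tower_map_inv_def)
next
  case False
  then have T: "tower_map \<alpha> y = frac (y + \<alpha>)" by (simp add: tower_map_def)
  have "frac (frac (y + \<alpha>) - \<alpha>) = frac (y + \<alpha> - \<alpha>)"
    using frac_add_simps(1)[of "y + \<alpha>" "- \<alpha>"] by simp
  moreover have "\<lfloor>1 / frac y\<rfloor> = \<lfloor>y\<rfloor>"
    using False assms by (auto simp: tower_def floor_eq_iff)
  ultimately show ?thesis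
    using frac_lt_1[of "y + \<alpha>"] unfolding T tower_map_inv_def by (simp add: frac_def[of y])
qed

lemma tower_map_tower_top: "tower_map \<alpha> (frac x + of_int \<lfloor>1 / frac x\<rfloor>) = frac (x + \<alpha>)"
proof -
  have "frac (frac x + of_int n + \<alpha>) = frac (x + \<alpha>)" for n
    using frac_add_simps(1)[of "frac x + of_int n" \<alpha>] by simp
  moreover have "\<not> of_int \<lfloor>1 / frac x\<rfloor> + 1 \<le> 1 / frac x" by linarith
  ultimately show ?thesis unfolding tower_map_def by simp
qed

lemma tower_map_tower_map_inv:
  assumes "z \<in> tower"
  shows "tower_map \<alpha> (tower_map_inv \<alpha> z) = z"
proof (cases "1 \<le> z")
  case True
  with assms show ?thesis by (simp add: tower_map_inv_def tower_map_def tower_def)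
next
  case False
  with tower_nonneg[OF assms] show ?thesis
    by (simp add: tower_map_inv_def tower_map_tower_top frac_eq)
qed

lemma bij_betw_tower_map: "bij_betw (tower_map \<alpha>) tower tower"
  by (rule bij_betw_byWitness[where f' = "tower_map_inv \<alpha>"])
    (auto simp: tower_map_inv_tower_map tower_map_tower_map_inv tower_map_in_tower
      tower_map_inv_in_tower)

lemma borel_measurable_frac [measurable]: "(frac :: real \<Rightarrow> real) \<in> borel_measurable borel"
  unfolding frac_def by measurable

lemma tower_borel [measurable]: "tower \<in> sets borel"
  unfolding tower_def by measurable

lemma borel_measurable_tower_map [measurable]: "tower_map \<alpha> \<in> borel_measurable borel"
  unfolding tower_map_def by measurable

lemma borel_measurable_tower_map_inv [measurable]: "tower_map_inv \<alpha> \<in> borel_measurable borel"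
  unfolding tower_map_inv_def by measurable

abbreviation tower_measure :: "real measure" where
  "tower_measure \<equiv> restrict_space lborel tower"

lemma space_tower_measure [simp]: "space tower_measure = tower"
  by (simp add: space_restrict_space)

lemma sets_tower_measure: "E \<in> sets tower_measure \<longleftrightarrow> E \<subseteq> tower \<and> E \<in> sets borel"
  by (simp add: sets_restrict_space_iff)

lemma emeasure_tower_measure: "E \<subseteq> tower \<Longrightarrow> emeasure tower_measure E = emeasure lborel E"
  by (simp add: emeasure_restrict_space)

lemma tower_map_measurable: "tower_map \<alpha> \<in> measurable tower_measure tower_measure"
  by (rule measurable_restrict_space3) (auto simp: tower_map_in_tower)

lemma tower_map_inv_measurable: "tower_map_inv \<alpha> \<in> measurable tower_measure tower_measure"
  by (rule measurable_restrict_space3) (auto simp: tower_map_inv_in_tower)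

lemma the_inv_into_tower_map: "z \<in> tower \<Longrightarrow> the_inv_into tower (tower_map \<alpha>) z = tower_map_inv \<alpha> z"
  using bij_betw_tower_map[of \<alpha>]
  by (intro the_inv_into_f_eq)
    (auto simp: bij_betw_def tower_map_tower_map_inv tower_map_inv_in_tower)

lemma invertible_tower_map: "invertible_transformation tower_measure (tower_map \<alpha>)"
proof -
  have "the_inv_into tower (tower_map \<alpha>) \<in> measurable tower_measure tower_measure"
    using tower_map_inv_measurable[of \<alpha>]
    by (subst measurable_cong[where g = "tower_map_inv \<alpha>"]) (simp_all add: the_inv_into_tower_map)
  then show ?thesis
    by (simp add: invertible_transformation_def tower_map_measurable bij_betw_tower_map)
qed

lemma measure_preserving_tower_map:
  "measure_preserving_transformation tower_measure (tower_map \<alpha>)"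
proof -
  \<comment> \<open>Climbing displaces by 1, dropping by \<alpha> minus the integer part of
    \<open>y + \<alpha>\<close>; hence only countably many displacements occur.\<close>
  let ?D = "insert 1 (range (\<lambda>n::int. \<alpha> - of_int n))"
  have "tower_map \<alpha> y - y \<in> ?D" for y
    by (auto simp: tower_map_def frac_def)
  then have "emeasure lborel (tower_map \<alpha> -` E \<inter> tower) = emeasure lborel E"
    if "E \<in> sets borel" "E \<subseteq> tower" for E
    using that by (intro emeasure_piecewise_translation[where D = ?D] bij_betw_tower_map) auto
  then show ?thesis
    by (auto simp: measure_preserving_transformation_def tower_map_measurable sets_tower_measure
        emeasure_tower_measure)
qed

lemma conservative_tower_map: "conservative_transformation tower_measure (tower_map \<alpha>)"
proof (rule conservative_if_backward_recurrent[where S = "tower_map_inv \<alpha>" and B = "{0..<1}"])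
  show "\<exists>n. (tower_map_inv \<alpha> ^^ n) y \<in> {0..<1}" if "y \<in> space tower_measure" for y
  proof -
    have "y \<in> tower \<Longrightarrow> y < real k + 1 \<Longrightarrow> \<exists>n. (tower_map_inv \<alpha> ^^ n) y \<in> {0..<1}" for k
    proof (induction k arbitrary: y)
      case 0
      then show ?case using tower_nonneg by (intro exI[of _ 0]) auto
    next
      case (Suc k)
      show ?case
      proof (cases "1 \<le> y")
        case True
        with Suc.prems have "y - 1 \<in> tower" "y - 1 < real k + 1" by (auto simp: tower_minus_1)
        then obtain n where "(tower_map_inv \<alpha> ^^ n) (y - 1) \<in> {0..<1}" using Suc.IH by blast
        then have "(tower_map_inv \<alpha> ^^ Suc n) y \<in> {0..<1}"
          using True by (simp add: funpow_swap1 tower_map_inv_def)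
        then show ?thesis by blast
      qed (use Suc.prems tower_nonneg in \<open>auto intro!: exI[of _ 0]\<close>)
    qed
    moreover obtain k where "y < real k" using reals_Archimedean2 by blast
    then have "y < real k + 1" by simp
    ultimately show ?thesis using that by simp
  qed
qed (use unit_interval_subset_tower in \<open>auto simp: measure_preserving_tower_map
  tower_map_inv_measurable tower_map_inv_tower_map sets_tower_measure emeasure_tower_measure\<close>)

text \<open>Invariance makes membership in \<open>E\<close> constant along each tower, so
  \<open>E\<close> is given by the set \<open>P\<close> of reals whose base point lies in it.
  Passing from the top of one tower to the base of the next makes \<open>P\<close> invariant under
  \<alpha>; it is 1-periodic by construction, and for irrational \<alpha> the translations so
  obtained are dense.\<close>

lemma ergodic_tower_map:
  assumes "\<alpha> \<notin> \<rat>"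
  shows "ergodic_transformation tower_measure (tower_map \<alpha>)"
  unfolding ergodic_transformation_def space_tower_measure
proof (intro conjI ballI impI tower_map_measurable)
  fix E assume "E \<in> sets tower_measure" and inv: "tower_map \<alpha> -` E \<inter> tower = E"
  then have E: "E \<subseteq> tower" "E \<in> sets borel" by (auto simp: sets_tower_measure)
  have TE: "tower_map \<alpha> y \<in> E \<longleftrightarrow> y \<in> E" if "y \<in> tower" for y using inv that by blast
  have frac_E: "y \<in> E \<longleftrightarrow> frac y \<in> E" if "y \<in> tower" for y
  proof -
    have "y \<in> tower \<Longrightarrow> y < real k + 1 \<Longrightarrow> y \<in> E \<longleftrightarrow> frac y \<in> E" for k
    proof (induction k arbitrary: y)
      case 0
      then have "frac y = y" using tower_nonneg by (simp add: frac_eq)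
      then show ?case by simp
    next
      case (Suc k)
      show ?case
      proof (cases "1 \<le> y")
        case True
        with Suc.prems have y: "y - 1 \<in> tower" "y - 1 < real k + 1" by (auto simp: tower_minus_1)
        have "tower_map \<alpha> (y - 1) = y"
          using tower_map_tower_map_inv[OF Suc.prems(1), of \<alpha>] True by (simp add: tower_map_inv_def)
        then show ?thesis using TE[OF y(1)] Suc.IH[OF y] by simp
      next
        case False
        then have "frac y = y" using tower_nonneg[OF Suc.prems(1)] by (simp add: frac_eq)
        then show ?thesis by simp
      qed
    qed
    moreover obtain k where "y < real k" using reals_Archimedean2 by blast
    then have "y < real k + 1" by simp
    ultimately show ?thesis using that by simp
  qed
  define P where "P = frac -` E"
  have P: "P \<in> sets borel"
    unfolding P_def using measurable_sets[OF borel_measurable_frac E(2)] by simp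
  have P1: "y + of_int n \<in> P \<longleftrightarrow> y \<in> P" for y n by (simp add: P_def)
  have P\<alpha>: "y + \<alpha> \<in> P \<longleftrightarrow> y \<in> P" for y
    using TE[OF tower_top[of y]] frac_E[OF tower_top[of y]]
    by (simp add: P_def tower_map_tower_top)
  have Pn: "y + real n * \<alpha> \<in> P \<longleftrightarrow> y \<in> P" for y n
  proof (induction n)
    case (Suc n)
    have "y + real (Suc n) * \<alpha> = y + real n * \<alpha> + \<alpha>" by (simp add: algebra_simps)
    with Suc P\<alpha> show ?case by metis
  qed simp
  have "emeasure lborel P = 0 \<or> emeasure lborel (- P) = 0"
  proof (rule translation_invariant_null_or_conull[OF P])
    fix x \<epsilon> :: real assume "\<epsilon> > 0"
    then obtain h k where k: "k > 0" "\<bar>of_int k * \<alpha> - of_int h - x\<bar> < \<epsilon>"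
      using sequence_of_fractional_parts_is_dense[OF assms] by metis
    have "y + (of_int k * \<alpha> - of_int h) \<in> P \<longleftrightarrow> y \<in> P" for y
      using P1[of "y + of_int k * \<alpha>" "- h"] Pn[of y "nat k"] k(1)
      by (simp add: add_diff_eq)
    with k(2) show "\<exists>g. (\<forall>y. y + g \<in> P \<longleftrightarrow> y \<in> P) \<and> \<bar>g - x\<bar> < \<epsilon>" by blast
  qed
  moreover have "E \<subseteq> P" "tower - E \<subseteq> - P"
    using E(1) frac_E by (auto simp: P_def)
  ultimately have "emeasure lborel E = 0 \<or> emeasure lborel (tower - E) = 0"
    using emeasure_mono[of E P lborel] emeasure_mono[of "tower - E" "- P" lborel] P by auto
  then show "emeasure tower_measure E = 0 \<or> emeasure tower_measure (tower - E) = 0"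
    using E(1) by (simp add: emeasure_tower_measure)
qed

text \<open>For \<open>n \<ge> 1\<close>, level \<open>n\<close> contains the points above
  \<open>(0, 1 / n]\<close>, so the levels of either parity have total length comparable to the
  harmonic series.\<close>

lemma emeasure_tower_residue_class:
  assumes "r < 2"
  shows "emeasure lborel {y \<in> tower. \<lfloor>y\<rfloor> mod 2 = int r} = \<infinity>"
proof -
  \<comment> \<open>\<open>k j\<close> runs through levels of the required parity, and
    \<open>k j \<le> 3 * (j + 1)\<close> places \<open>I j\<close> inside level \<open>k j\<close>
    of the tower. The left end is open because \<open>1 / 0 = 0\<close> leaves the base point 0
    without any level above 0.\<close>
  define k where "k j = 2 * (j + 1) + r" for j
  define I where "I j = {real (k j)<..real (k j) + 1 / (3 * real (Suc j))}" for j
  have floor: "\<lfloor>y\<rfloor> = int (k j)" if "y \<in> I j" for y j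
  proof -
    have "1 / (3 * real (Suc j)) < 1" by simp
    moreover have "real (k j) < y" "y \<le> real (k j) + 1 / (3 * real (Suc j))"
      using that by (simp_all add: I_def)
    ultimately have "real (k j) \<le> y" "y < real (k j) + 1" by linarith+
    then show ?thesis by (simp add: floor_eq_iff)
  qed
  have "y \<in> tower \<and> \<lfloor>y\<rfloor> mod 2 = int r" if y: "y \<in> I j" for y j
  proof
    have f: "0 < frac y" "frac y \<le> 1 / (3 * real (Suc j))"
      using y floor[OF y] by (auto simp: I_def frac_def)
    have "real (k j) \<le> 3 * real (Suc j)" using assms by (simp add: k_def)
    also have "\<dots> \<le> 1 / frac y" using f by (simp add: field_simps)
    finally have "of_int \<lfloor>y\<rfloor> \<le> 1 / frac y" "0 \<le> \<lfloor>y\<rfloor>" unfolding floor[OF y] by simp_all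
    then show "y \<in> tower" unfolding tower_def by blast
    show "\<lfloor>y\<rfloor> mod 2 = int r" using assms by (simp add: floor[OF y] k_def)
  qed
  then have "(\<Union>j. I j) \<subseteq> {y \<in> tower. \<lfloor>y\<rfloor> mod 2 = int r}" by blast
  moreover have "{y \<in> tower. \<lfloor>y\<rfloor> mod 2 = int r} \<in> sets borel" by measurable
  moreover have "emeasure lborel (\<Union>j. I j) = \<infinity>"
  proof -
    have "disjoint_family I"
      unfolding disjoint_family_on_def
    proof (intro ballI impI)
      fix i j :: nat assume "i \<noteq> j"
      then have "int (k i) \<noteq> int (k j)" by (simp add: k_def)
      then show "I i \<inter> I j = {}" using floor by (metis disjoint_iff)
    qed
    moreover have "I j \<in> sets lborel" for j by (simp add: I_def)
    ultimately have "emeasure lborel (\<Union>j. I j) = (\<Sum>j. emeasure lborel (I j))"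
      by (intro suminf_emeasure[symmetric]) auto
    also have "\<dots> = (\<Sum>j. ennreal (1 / (3 * real (Suc j))))"
      by (simp add: I_def)
    also have "\<dots> = top"
    proof (rule summable_iff_suminf_neq_top)
      show "\<not> summable (\<lambda>j. 1 / (3 * real (Suc j)))"
      proof
        assume "summable (\<lambda>j. 1 / (3 * real (Suc j)))"
        then have "summable (\<lambda>j. 3 * (1 / (3 * real (Suc j))))" by (rule summable_mult)
        moreover have "3 * (1 / (3 * real (Suc j))) = inverse (real (Suc j))" for j
          by (simp add: divide_simps del: of_nat_Suc)
        ultimately have "summable (\<lambda>j. inverse (real (Suc j)))" by simp
        then show False
          using not_summable_harmonic[where 'a = real] summable_Suc_iff[of "\<lambda>n. inverse (real n)"]
          by blast
      qed
    qed simp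
    finally show ?thesis by simp
  qed
  ultimately show ?thesis
    using emeasure_mono[of "\<Union>j. I j" "{y \<in> tower. \<lfloor>y\<rfloor> mod 2 = int r}" lborel]
    by (simp add: top_unique)
qed

section \<open>Oscillating exhaustions\<close>

text \<open>Whenever one family is enlarged, it is made at least three times as large as the current
  part of the other, which lifts its share to at least 3/4.\<close>

lemma oscillating_exhaustion:
  assumes A: "incseq A" "\<And>n. A n \<in> sets M" "\<And>n. emeasure M (A n) < \<infinity>" "emeasure M (\<Union>n. A n) = \<infinity>"
    and B: "incseq B" "\<And>n. B n \<in> sets M" "\<And>n. emeasure M (B n) < \<infinity>" "emeasure M (\<Union>n. B n) = \<infinity>"
    and disj: "(\<Union>n. A n) \<inter> (\<Union>n. B n) = {}"
  obtains F where "incseq F" "\<forall>l. F l \<in> sets M \<and> 0 < emeasure M (F l) \<and> emeasure M (F l) < \<infinity>"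
    "(\<Union>l. F l) = (\<Union>n. A n) \<union> (\<Union>n. B n)"
    "\<forall>l. even l \<longrightarrow> 3 / 4 \<le> measure M (F l \<inter> (\<Union>n. A n)) / measure M (F l)"
    "\<forall>l. odd l \<longrightarrow> measure M (F l \<inter> (\<Union>n. A n)) / measure M (F l) \<le> 1 / 4"
proof -
  define a b where "a n = measure M (A n)" and "b n = measure M (B n)" for n
  have large: "\<forall>\<^sub>F n in sequentially. c \<le> measure M (D n)"
    if D: "incseq D" "\<And>n. D n \<in> sets M" "\<And>n. emeasure M (D n) < \<infinity>" "emeasure M (\<Union>n. D n) = \<infinity>"
    for c and D :: "nat \<Rightarrow> 'a set"
  proof -
    have "(\<lambda>n. emeasure M (D n)) \<longlonglongrightarrow> \<infinity>"
      using Lim_emeasure_incseq[of D M] D by auto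
    then have "\<forall>\<^sub>F n in sequentially. ennreal c < emeasure M (D n)"
      by (rule order_tendstoD) simp
    then show ?thesis
    proof eventually_elim
      case (elim n)
      then have "ennreal c < ennreal (measure M (D n))"
        using D(3)[of n] by (simp add: emeasure_eq_ennreal_measure)
      then show ?case by (metis ennreal_leI less_le_not_le linorder_le_cases)
    qed
  qed
  \<comment> \<open>One index sequence \<open>r\<close> serves all comparisons. The summand 1 keeps
    the measures of the later unions positive; the conjunct \<open>True\<close> is the trivial state
    condition of the dependent choice rule.\<close>
  have "\<exists>r. \<forall>n. True \<and> (r n < r (Suc n) \<and> 3 * b (r n) + 1 \<le> a (r (Suc n))
      \<and> 3 * a (r n) + 1 \<le> b (r (Suc n)))"
  proof (rule dependent_nat_choice)
    fix x n :: nat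
    have "\<forall>\<^sub>F m in sequentially. x < m \<and> 3 * b x + 1 \<le> a m \<and> 3 * a x + 1 \<le> b m"
      unfolding a_def b_def
      by (intro eventually_conj eventually_gt_at_top large A B)
    then show "\<exists>m. True \<and> (x < m \<and> 3 * b x + 1 \<le> a m \<and> 3 * a x + 1 \<le> b m)"
      using eventually_happens trivial_limit_sequentially by blast
  qed simp
  then obtain r where r: "\<And>n. r n < r (Suc n)" "\<And>n. 3 * b (r n) + 1 \<le> a (r (Suc n))"
    "\<And>n. 3 * a (r n) + 1 \<le> b (r (Suc n))" by blast
  \<comment> \<open>At even \<open>l\<close> the family \<open>A\<close> is one step ahead of
    \<open>B\<close>, at odd \<open>l\<close> one step behind. Passing from \<open>l\<close> to
    \<open>l + 1\<close> thus advances one of the two positions by two steps and leaves the other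
    fixed, so both \<open>p\<close> and \<open>q\<close> are monotone.\<close>
  define p q where "p l = (if even l then r (Suc l) else r l)"
    and "q l = (if even l then r l else r (Suc l))" for l
  have pq_mono: "p l \<le> p (Suc l)" "q l \<le> q (Suc l)" for l
    using r(1)[of l] r(1)[of "Suc l"] by (auto simp: p_def q_def)
  define F where "F l = A (p l) \<union> B (q l)" for l
  have "strict_mono r" using r(1) by (rule strict_mono_Suc_iff[THEN iffD2, OF allI])
  then have "l \<le> r l" for l by (rule strict_mono_imp_increasing)
  then have pq_ge: "l \<le> p l" "l \<le> q l" for l
    using less_imp_le[OF r(1)] by (auto simp: p_def q_def intro: order_trans)
  have F_sets: "F l \<in> sets M" for l using A(2) B(2) by (auto simp: F_def)
  have ab: "0 \<le> a n" "0 \<le> b n" for n by (simp_all add: a_def b_def)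
  have F_fin: "emeasure M (F l) < \<infinity>" for l
    using emeasure_subadditive[OF A(2) B(2), of "p l" "q l"] A(3)[of "p l"] B(3)[of "q l"]
    by (auto simp: F_def intro: le_less_trans)
  have "A m \<inter> B n = {}" for m n using disj by blast
  then have F_meas: "measure M (F l) = a (p l) + b (q l)" for l
    unfolding F_def a_def b_def using A(2,3) B(2,3)
    by (intro measure_Union) (auto simp: less_top)
  have F_A: "F l \<inter> (\<Union>n. A n) = A (p l)" for l
    using disj by (auto simp: F_def)
  have pos: "0 < a (p l) + b (q l)" for l
    using r(2,3)[of l] ab[of "r l"] ab[of "r (Suc l)"] by (auto simp: p_def q_def)
  show thesis
  proof (rule that[of F])
    show "incseq F"
      unfolding F_def using pq_mono A(1) B(1)
      by (intro incseq_SucI Un_mono) (auto simp: incseq_def)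
    show "\<forall>l. F l \<in> sets M \<and> 0 < emeasure M (F l) \<and> emeasure M (F l) < \<infinity>"
    proof (intro allI conjI F_sets F_fin)
      fix l show "0 < emeasure M (F l)"
        using F_fin[of l] F_meas[of l] pos[of l] by (simp add: emeasure_eq_ennreal_measure)
    qed
    show "\<forall>l. even l \<longrightarrow> 3 / 4 \<le> measure M (F l \<inter> (\<Union>n. A n)) / measure M (F l)"
      unfolding F_A F_meas a_def[symmetric]
    proof (intro allI impI)
      fix l :: nat assume "even l"
      then show "3 / 4 \<le> a (p l) / (a (p l) + b (q l))"
        using pos[of l] r(2)[of l] by (simp add: p_def q_def field_simps)
    qed
    show "\<forall>l. odd l \<longrightarrow> measure M (F l \<inter> (\<Union>n. A n)) / measure M (F l) \<le> 1 / 4"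
      unfolding F_A F_meas a_def[symmetric]
    proof (intro allI impI)
      fix l :: nat assume "odd l"
      then show "a (p l) / (a (p l) + b (q l)) \<le> 1 / 4"
        using pos[of l] r(3)[of l] by (simp add: p_def q_def field_simps)
    qed
    show "(\<Union>l. F l) = (\<Union>n. A n) \<union> (\<Union>n. B n)"
      using pq_ge incseqD[OF A(1)] incseqD[OF B(1)] by (fastforce simp: F_def)
  qed
qed

section \<open>Polynomials of self-adjoint operators\<close>

lemma cinner_basis_left: "cinner (ell2_basis k) x = ell2_nth x k"
proof -
  have "cinner (ell2_basis k) x = (\<Sum>\<^sub>\<infinity>n\<in>{k}. ell2_nth x n)"
    unfolding cinner_def by (rule infsum_cong_neutral) auto
  then show ?thesis by simp
qed

lemma norm_ell2_basis [simp]: "norm (ell2_basis k) = 1"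
  using cinner_basis_left[of k "ell2_basis k"] by (simp add: norm_eq_sqrt_inner inner_ell2_def)

lemma poly_op_altdef:
  assumes "degree p \<le> n"
  shows "poly_op p A = (\<Sum>i\<le>n. coeff p i *\<^sub>R (((o\<^sub>L) A ^^ i) id_blinfun))"
  unfolding poly_op_def
  by (rule sum.mono_neutral_left) (use assms in \<open>auto simp: coeff_eq_0\<close>)

lemma poly_op_0 [simp]: "poly_op 0 A = 0"
  by (simp add: poly_op_def)

lemma poly_op_pCons_apply [simp]:
  "blinfun_apply (poly_op (pCons a p) A) u = a *\<^sub>R u + A (poly_op p A u)"
proof -
  have "poly_op (pCons a p) A
      = (\<Sum>i\<le>Suc (degree p). coeff (pCons a p) i *\<^sub>R (((o\<^sub>L) A ^^ i) id_blinfun))"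
    by (rule poly_op_altdef) (rule degree_pCons_le)
  also have "\<dots> = a *\<^sub>R id_blinfun
      + (\<Sum>i\<le>degree p. coeff p i *\<^sub>R (A o\<^sub>L ((o\<^sub>L) A ^^ i) id_blinfun))"
    by (subst sum.atMost_Suc_shift) simp
  finally show ?thesis
    by (simp add: poly_op_def blinfun.add_left blinfun.sum_left blinfun.scaleR_left
        blinfun.sum_right blinfun.scaleR_right)
qed

lemma poly_op_add: "poly_op (p + q) A = poly_op p A + poly_op q A"
  by (induction p q rule: poly_induct2)
    (auto intro!: blinfun_eqI simp: blinfun.bilinear_simps algebra_simps)

lemma poly_op_smult: "poly_op (smult c p) A = c *\<^sub>R poly_op p A"
  by (induction p) (auto intro!: blinfun_eqI simp: blinfun.bilinear_simps algebra_simps)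

lemma poly_op_diff: "poly_op (p - q) A = poly_op p A - poly_op q A"
  using poly_op_add[of "p - q" q A] by simp

lemma poly_op_mult_apply:
  "blinfun_apply (poly_op (p * q) A) u = poly_op p A (poly_op q A u)"
proof (induction p)
  case (pCons a p)
  then show ?case
    by (simp add: mult_pCons_left poly_op_add poly_op_smult blinfun.bilinear_simps)
qed simp

text \<open>Stated with the real inner product, the real part of \<open>cinner\<close>, since the
  operators are only real-linear by type. For complex-linear operators this agrees with the usual
  notion.\<close>

definition self_adjoint :: "(ell2 \<Rightarrow>\<^sub>L ell2) \<Rightarrow> bool" where
  "self_adjoint A \<longleftrightarrow> (\<forall>x y. inner (A x) y = inner x (A y))"

lemma self_adjoint_poly_op:
  assumes "self_adjoint A"
  shows "self_adjoint (poly_op p A)"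
proof -
  have "inner (poly_op p A x) y = inner x (poly_op p A y)" for x y
  proof (induction p arbitrary: x y)
    case (pCons a p)
    have "A (poly_op p A x) = poly_op p A (A x)" for x
      using poly_op_mult_apply[of "[:0, 1:]" p A x] poly_op_mult_apply[of p "[:0, 1:]" A x]
      by (simp add: mult.commute blinfun.bilinear_simps)
    with pCons assms show ?case
      by (simp add: inner_add_left inner_add_right self_adjoint_def)
  qed simp
  then show ?thesis by (simp add: self_adjoint_def)
qed

text \<open>This lower bound stands in for invertibility: it is stable under composition, hence
  under multiplying the factors of a polynomial, and it excludes approximate eigenvectors for the
  eigenvalue 0.\<close>

definition bounded_below :: "(ell2 \<Rightarrow>\<^sub>L ell2) \<Rightarrow> bool" where
  "bounded_below A \<longleftrightarrow> (\<exists>c>0. \<forall>u. c * norm u \<le> norm (A u))"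

lemma bounded_below_compose:
  assumes "bounded_below A" "bounded_below B"
  shows "bounded_below (A o\<^sub>L B)"
proof -
  from assms obtain c d where "c > 0" "d > 0"
    and c: "\<And>u. c * norm u \<le> norm (A u)" and d: "\<And>u. d * norm u \<le> norm (B u)"
    by (auto simp: bounded_below_def)
  have "(c * d) * norm u \<le> norm ((A o\<^sub>L B) u)" for u
    using order_trans[OF mult_left_mono[OF d[of u], of c] c[of "B u"]] \<open>c > 0\<close>
    by (simp add: mult.assoc)
  with \<open>c > 0\<close> \<open>d > 0\<close> show ?thesis
    unfolding bounded_below_def by (intro exI[of _ "c * d"]) auto
qed

lemma Blinfun_cscale_of_real [simp]:
  "blinfun_apply (Blinfun (cscale (complex_of_real x))) u = x *\<^sub>R u"
  by (auto intro!: ell2_eqI simp: bounded_linear_Blinfun_apply bounded_linear_cscale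
      scaleR_conv_of_real)

lemma bounded_below_if_not_spectrum:
  assumes "complex_of_real x \<notin> spectrum A"
  shows "bounded_below (poly_op [:- x, 1:] A)"
proof -
  obtain B where B: "B o\<^sub>L (A - Blinfun (cscale x)) = id_blinfun"
    using assms by (auto simp: spectrum_def)
  have "1 / (norm B + 1) * norm u \<le> norm (poly_op [:- x, 1:] A u)" for u
  proof -
    have u: "u = B (A u - x *\<^sub>R u)"
      using arg_cong[OF B, of "\<lambda>C. blinfun_apply C u"] by (simp add: blinfun.bilinear_simps)
    have "norm u \<le> norm B * norm (A u - x *\<^sub>R u)"
      by (subst u) (rule norm_blinfun)
    also have "\<dots> \<le> (norm B + 1) * norm (A u - x *\<^sub>R u)"
      by (simp add: mult_right_mono)
    finally have "norm u / (norm B + 1) \<le> norm (A u - x *\<^sub>R u)"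
      by (simp add: pos_divide_le_eq add_nonneg_pos mult.commute)
    then show ?thesis by (simp add: blinfun.bilinear_simps)
  qed
  then show ?thesis
    unfolding bounded_below_def
    by (intro exI[of _ "1 / (norm B + 1)"]) (auto simp: add_nonneg_pos)
qed

text \<open>The polynomial is \<open>(x - a)\<^sup>2 + b\<^sup>2\<close>, so the quadratic form of
  the operator is at least \<open>b\<^sup>2 * inner u u\<close>, and Cauchy-Schwarz turns this into
  a bound for the norm.\<close>

lemma bounded_below_quadratic:
  assumes "self_adjoint A" "b \<noteq> 0"
  shows "bounded_below (poly_op [:a\<^sup>2 + b\<^sup>2, - (2 * a), 1:] A)"
proof -
  let ?Q = "poly_op [:a\<^sup>2 + b\<^sup>2, - (2 * a), 1:] A"
  have "b\<^sup>2 * norm u \<le> norm (?Q u)" for u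
  proof (cases "u = 0")
    case False
    have "inner (A (A u)) u = inner (A u) (A u)"
      using assms by (simp add: self_adjoint_def)
    then have "inner (?Q u) u = inner (A u - a *\<^sub>R u) (A u - a *\<^sub>R u) + b\<^sup>2 * inner u u"
      by (simp add: blinfun.scaleR_right blinfun.diff_right blinfun.add_right
          inner_add_left inner_diff_left inner_diff_right
          inner_commute[of u "A u"] power2_eq_square algebra_simps)
    then have "b\<^sup>2 * inner u u \<le> inner (?Q u) u" by simp
    also have "\<dots> \<le> norm (?Q u) * norm u" by (rule norm_cauchy_schwarz)
    finally show ?thesis
      using False by (simp add: dot_square_norm power2_eq_square)
  qed simp
  with assms(2) show ?thesis
    unfolding bounded_below_def by (intro exI[of _ "b\<^sup>2"]) auto
qed

lemma of_real_poly_map_poly: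
  "complex_of_real (poly p x) = poly (map_poly complex_of_real p) (complex_of_real x)"
  by (induction p) (simp_all add: map_poly_pCons)

lemma poly_map_poly_of_real_add:
  "poly (map_poly complex_of_real (p + q)) z
     = poly (map_poly complex_of_real p) z + poly (map_poly complex_of_real q) z"
  by (induction p q rule: poly_induct2) (simp_all add: map_poly_pCons algebra_simps)

lemma poly_map_poly_of_real_mult:
  "poly (map_poly complex_of_real (p * q)) z
     = poly (map_poly complex_of_real p) z * poly (map_poly complex_of_real q) z"
proof (induction p)
  case (pCons a p)
  have "poly (map_poly complex_of_real (smult a q)) z
      = complex_of_real a * poly (map_poly complex_of_real q) z"
    by (induction q) (simp_all add: map_poly_pCons algebra_simps)
  with pCons show ?case
    by (simp add: mult_pCons_left poly_map_poly_of_real_add map_poly_pCons algebra_simps)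
qed simp

text \<open>Split off real linear factors and positive real quadratic factors of \<open>q\<close> one at a time.\<close>

lemma bounded_below_poly_op:
  assumes "self_adjoint A" "q \<noteq> 0"
    and "\<And>x. complex_of_real x \<in> spectrum A \<Longrightarrow> poly q x \<noteq> 0"
  shows "bounded_below (poly_op q A)"
  using assms(2,3)
proof (induction "degree q" arbitrary: q rule: less_induct)
  case less
  show ?case
  proof (cases "degree q = 0")
    case True
    then obtain a where "q = [:a:]" using degree_eq_zeroE by blast
    with less.prems show ?thesis
      unfolding bounded_below_def by (intro exI[of _ "\<bar>a\<bar>"]) (simp add: blinfun.bilinear_simps)
  next
    case False
    have factor: ?thesis if d: "bounded_below (poly_op d A)" "degree d > 0" "d dvd q" for d
    proof -
      obtain r where r: "q = d * r" using \<open>d dvd q\<close> by auto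
      with less.prems have "d \<noteq> 0" "r \<noteq> 0" by auto
      then have "bounded_below (poly_op r A)"
        using less.prems(2) d(2) by (intro less.hyps) (auto simp: r degree_mult_eq)
      moreover have "poly_op q A = poly_op d A o\<^sub>L poly_op r A"
        by (rule blinfun_eqI) (simp add: r poly_op_mult_apply)
      ultimately show ?thesis using bounded_below_compose d(1) by simp
    qed
    have "degree (map_poly complex_of_real q) \<noteq> 0"
      using False by (simp add: degree_map_poly)
    then obtain z where z: "poly (map_poly complex_of_real q) z = 0"
      using fundamental_theorem_of_algebra constant_degree by metis
    define a b where "a = Re z" and "b = Im z"
    show ?thesis
    proof (cases "b = 0")
      case True
      then have "z = complex_of_real a" by (simp add: a_def b_def complex_eq_iff)
      with z have "poly q a = 0"
        by (simp flip: of_real_poly_map_poly)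
      with less.prems(2) have "complex_of_real a \<notin> spectrum A" by blast
      then show ?thesis
        using \<open>poly q a = 0\<close>
        by (intro factor[of "[:- a, 1:]"] bounded_below_if_not_spectrum)
          (auto simp: poly_eq_0_iff_dvd)
    next
      case False
      define d where "d = [:a\<^sup>2 + b\<^sup>2, - (2 * a), 1:]"
      have "d \<noteq> 0" by (simp add: d_def)
      have "degree (q mod d) < 2"
        using degree_mod_less[OF \<open>d \<noteq> 0\<close>, of q] by (auto simp: d_def)
      then have "coeff (q mod d) n = coeff [:coeff (q mod d) 0, coeff (q mod d) 1:] n" for n
        by (cases "n < 2") (auto simp: coeff_eq_0 less_2_cases_iff coeff_pCons split: nat.split)
      then obtain c0 c1 where c: "q mod d = [:c0, c1:]" by (metis poly_eqI)
      have "poly (map_poly complex_of_real d) z = 0"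
        by (simp add: d_def map_poly_pCons complex_eq_iff a_def b_def power2_eq_square
            algebra_simps)
      moreover have "poly (map_poly complex_of_real (d * (q div d) + q mod d)) z = 0"
        by (simp only: mult_div_mod_eq z)
      ultimately have "poly (map_poly complex_of_real (q mod d)) z = 0"
        by (simp only: poly_map_poly_of_real_add poly_map_poly_of_real_mult mult_zero_left add_0)
      \<comment> \<open>Imaginary and real part of \<open>c0 + c1 * z = 0\<close>; as
        \<open>b \<noteq> 0\<close>, the remainder vanishes.\<close>
      then have "c1 * b = 0" "c0 + c1 * a = 0"
        by (simp_all add: c map_poly_pCons complex_eq_iff a_def b_def algebra_simps)
      with \<open>b \<noteq> 0\<close> c have "d dvd q" by auto
      then show ?thesis
        using bounded_below_quadratic[OF assms(1) False, of a]
        by (intro factor[of d]) (auto simp: d_def)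
    qed
  qed
qed

text \<open>With \<open>N = norm P\<close>, expanding the square and using
  \<open>norm (P (P u)) \<le> N * norm (P u)\<close> would turn such a \<open>c\<close> into
  \<open>(norm (P u))\<^sup>2 \<le> (N\<^sup>2 - c\<^sup>2 / N\<^sup>2) * (norm u)\<^sup>2\<close>
  when \<open>N > 0\<close>, a bound better than the operator norm.\<close>

lemma not_bounded_below_norm:
  assumes "self_adjoint P"
  shows "\<not> (\<exists>c>0. \<forall>u. c * norm u \<le> norm (P (P u) - (norm P)\<^sup>2 *\<^sub>R u))"
proof
  let ?N = "norm P"
  assume "\<exists>c>0. \<forall>u. c * norm u \<le> norm (P (P u) - ?N\<^sup>2 *\<^sub>R u)"
  then obtain c where c: "c > 0" "\<And>u. c * norm u \<le> norm (P (P u) - ?N\<^sup>2 *\<^sub>R u)" by blast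
  have key: "c\<^sup>2 * (norm u)\<^sup>2 \<le> ?N\<^sup>2 * (?N\<^sup>2 * (norm u)\<^sup>2 - (norm (P u))\<^sup>2)" for u
  proof -
    have "c\<^sup>2 * (norm u)\<^sup>2 \<le> (norm (P (P u) - ?N\<^sup>2 *\<^sub>R u))\<^sup>2"
      using power_mono[OF c(2)[of u], of 2] c(1) by (simp add: power_mult_distrib)
    also have "\<dots> = (norm (P (P u)))\<^sup>2 - 2 * ?N\<^sup>2 * (norm (P u))\<^sup>2 + (?N\<^sup>2)\<^sup>2 * (norm u)\<^sup>2"
    proof -
      have "(norm (w - m *\<^sub>R u))\<^sup>2 = (norm w)\<^sup>2 - 2 * m * inner w u + m\<^sup>2 * (norm u)\<^sup>2" for w m
        unfolding power2_norm_eq_inner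
        by (simp add: inner_diff_left inner_diff_right inner_commute[of u w] power2_eq_square algebra_simps)
      moreover have "inner (P (P u)) u = (norm (P u))\<^sup>2"
        using assms by (simp add: self_adjoint_def power2_norm_eq_inner)
      ultimately show ?thesis by simp
    qed
    also have "(norm (P (P u)))\<^sup>2 \<le> ?N\<^sup>2 * (norm (P u))\<^sup>2"
      using power_mono[OF norm_blinfun[of P "P u"], of 2] by (simp add: power_mult_distrib)
    finally show ?thesis by (simp add: algebra_simps power2_eq_square)
  qed
  show False
  proof (cases "?N = 0")
    case True
    with key[of "ell2_basis 0"] c(1) show False by simp
  next
    case False
    then have N: "?N > 0" by simp
    have le: "(norm (P u))\<^sup>2 \<le> (?N\<^sup>2 - c\<^sup>2 / ?N\<^sup>2) * (norm u)\<^sup>2" for u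
      using key[of u] N by (simp add: field_simps)
    have nn: "0 \<le> ?N\<^sup>2 - c\<^sup>2 / ?N\<^sup>2"
      using order_trans[OF zero_le_power2 le[of "ell2_basis 0"]] by simp
    have "norm P \<le> sqrt (?N\<^sup>2 - c\<^sup>2 / ?N\<^sup>2)"
    proof (rule norm_blinfun_bound)
      fix u show "norm (P u) \<le> sqrt (?N\<^sup>2 - c\<^sup>2 / ?N\<^sup>2) * norm u"
      proof (rule power2_le_imp_le)
        show "(norm (P u))\<^sup>2 \<le> (sqrt (?N\<^sup>2 - c\<^sup>2 / ?N\<^sup>2) * norm u)\<^sup>2"
          using le[of u] by (simp only: power_mult_distrib real_sqrt_pow2[OF nn])
        show "0 \<le> sqrt (?N\<^sup>2 - c\<^sup>2 / ?N\<^sup>2) * norm u"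
          using nn by (intro mult_nonneg_nonneg real_sqrt_ge_zero norm_ge_zero)
      qed
    qed (use nn in simp)
    also have "\<dots> < sqrt (?N\<^sup>2)" using N c(1) by (intro real_sqrt_less_mono) simp
    finally show False by simp
  qed
qed

text \<open>For \<open>P = p(A)\<close> the operator \<open>P\<^sup>2 - \<parallel>P\<parallel>\<^sup>2\<close> is never bounded below.\<close>

lemma norm_poly_op_attained:
  assumes "self_adjoint A" and "p * p \<noteq> [:(norm (poly_op p A))\<^sup>2:]"
  shows "\<exists>x. complex_of_real x \<in> spectrum A \<and> \<bar>poly p x\<bar> = norm (poly_op p A)"
proof (rule ccontr)
  let ?N = "norm (poly_op p A)"
  let ?q = "p * p - [:?N\<^sup>2:]"
  assume "\<not> ?thesis"
  then have "poly ?q x \<noteq> 0" if "complex_of_real x \<in> spectrum A" for x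
    using that power2_eq_iff_nonneg[of "\<bar>poly p x\<bar>" ?N] by (auto simp: power2_eq_square)
  \<comment> \<open>For constant \<open>p\<close> this difference vanishes identically; that case is
    treated separately in \<open>norm_poly_op_le\<close>.\<close>
  moreover have "?q \<noteq> 0" using assms(2) by simp
  ultimately have "bounded_below (poly_op ?q A)"
    using bounded_below_poly_op assms(1) by blast
  then show False
    using not_bounded_below_norm[OF self_adjoint_poly_op[OF assms(1)], of p]
    by (simp add: bounded_below_def poly_op_diff poly_op_mult_apply blinfun.bilinear_simps)
qed

text \<open>Norm attainment for the polynomial \<open>[:0, 1:]\<close> puts \<open>norm A\<close> or
  \<open>- norm A\<close> into the spectrum.\<close>

lemma real_spectrum_nonempty:
  assumes "self_adjoint A"
  shows "\<exists>x. complex_of_real x \<in> spectrum A"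
proof -
  have "[:0, 1:] * [:0, 1:] \<noteq> [:(norm (poly_op [:0, 1:] A))\<^sup>2:]" by simp
  from norm_poly_op_attained[OF assms this] show ?thesis by blast
qed

text \<open>Attainment settles nonconstant \<open>p\<close>. For constant \<open>p\<close> the norm
  is the absolute value of the constant, and a point of the spectrum is needed to compare it with
  \<open>s\<close>.\<close>

lemma norm_poly_op_le:
  assumes "self_adjoint A"
    and le: "\<And>x. complex_of_real x \<in> spectrum A \<Longrightarrow> \<bar>poly p x\<bar> \<le> s"
  shows "norm (poly_op p A) \<le> s"
proof (cases "p * p = [:(norm (poly_op p A))\<^sup>2:]")
  case True
  obtain x where x: "complex_of_real x \<in> spectrum A"
    using real_spectrum_nonempty[OF assms(1)] by blast
  have "(poly p x)\<^sup>2 = (norm (poly_op p A))\<^sup>2"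
    using arg_cong[OF True, of "\<lambda>q. poly q x"] by (simp add: power2_eq_square)
  then have "norm (poly_op p A) = \<bar>poly p x\<bar>"
    by (metis abs_norm_cancel power2_eq_iff abs_minus_cancel)
  with le[OF x] show ?thesis by simp
next
  case False
  with norm_poly_op_attained[OF assms(1)] le show ?thesis by metis
qed

section \<open>Neumann series and boundedness of the real spectrum\<close>

interpretation blinfun_compose: bounded_bilinear "(o\<^sub>L)"
  by (rule bounded_bilinear_blinfun_compose)

lemma blinfun_compose_assoc: "(A o\<^sub>L B) o\<^sub>L C = A o\<^sub>L (B o\<^sub>L C)"
  by (rule blinfun_eqI) simp

lemma blinfun_neumann:
  fixes C :: "'a::banach \<Rightarrow>\<^sub>L 'a"
  assumes "norm C < 1"
  shows "\<exists>S. S o\<^sub>L (C - id_blinfun) = id_blinfun \<and> (C - id_blinfun) o\<^sub>L S = id_blinfun"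
proof -
  define c where "c n = ((o\<^sub>L) C ^^ n) id_blinfun" for n
  have step: "C o\<^sub>L c n = c (Suc n)" for n by (simp add: c_def)
  have step': "c n o\<^sub>L C = c (Suc n)" for n
    by (induction n) (auto simp: c_def blinfun_compose_assoc intro: blinfun_eqI)
  have "norm (c n) \<le> norm C ^ n" for n
  proof (induction n)
    case 0
    show ?case by (simp add: c_def norm_blinfun_id_le)
  next
    case (Suc n)
    have "norm (C o\<^sub>L c n) \<le> norm C * norm (c n)" by (rule norm_blinfun_compose)
    also have "\<dots> \<le> norm C * norm C ^ n" using Suc by (simp add: mult_left_mono)
    finally show ?case by (simp add: step)
  qed
  then have sum: "summable c"
    using assms by (intro summable_comparison_test'[of "\<lambda>n. norm C ^ n" 0 c] summable_geometric) simp_all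
  define S where "S = suminf c"
  have "(\<Sum>n. c (Suc n)) = S - id_blinfun"
    using suminf_split_head[OF sum] by (simp add: S_def c_def)
  moreover have "C o\<^sub>L S = (\<Sum>n. c (Suc n))"
    unfolding S_def step[symmetric]
    by (rule bounded_linear.suminf[OF blinfun_compose.bounded_linear_right sum])
  moreover have "S o\<^sub>L C = (\<Sum>n. c (Suc n))"
    unfolding S_def step'[symmetric]
    by (rule bounded_linear.suminf[OF blinfun_compose.bounded_linear_left sum])
  moreover have "S o\<^sub>L id_blinfun = S" "id_blinfun o\<^sub>L S = S"
    by (auto intro: blinfun_eqI)
  ultimately show ?thesis
    by (intro exI[of _ "- S"]) (simp add: blinfun_compose.diff_left blinfun_compose.diff_right
        blinfun_compose.minus_left blinfun_compose.minus_right)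
qed

lemma real_spectrum_bounded:
  assumes "complex_of_real x \<in> spectrum A"
  shows "\<bar>x\<bar> \<le> norm A"
proof (rule ccontr)
  assume "\<not> \<bar>x\<bar> \<le> norm A"
  then have x: "norm A < \<bar>x\<bar>" "x \<noteq> 0" using norm_ge_zero[of A] by linarith+
  have eq: "A - Blinfun (cscale (complex_of_real x)) = x *\<^sub>R ((1 / x) *\<^sub>R A - id_blinfun)"
    using x by (intro blinfun_eqI) (simp add: blinfun.bilinear_simps scaleR_diff_right)
  have "norm ((1 / x) *\<^sub>R A) < 1" using x by simp
  then obtain S where "S o\<^sub>L ((1 / x) *\<^sub>R A - id_blinfun) = id_blinfun"
      "((1 / x) *\<^sub>R A - id_blinfun) o\<^sub>L S = id_blinfun"
    using blinfun_neumann by blast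
  then have "((1 / x) *\<^sub>R S) o\<^sub>L (A - Blinfun (cscale (complex_of_real x))) = id_blinfun"
    "(A - Blinfun (cscale (complex_of_real x))) o\<^sub>L ((1 / x) *\<^sub>R S) = id_blinfun"
    unfolding eq blinfun_compose.scaleR_left blinfun_compose.scaleR_right using x by simp_all
  with assms show False unfolding spectrum_def by blast
qed

section \<open>The functional calculus\<close>

text \<open>Resolves the definite description: two admissible polynomial sequences are uniformly
  close on the spectrum, so by \<open>norm_poly_op_le\<close> their operators are close in norm and
  have the same limit.\<close>

lemma fun_calc_eqI:
  assumes "self_adjoint A"
    and p: "uniform_limit {x. complex_of_real x \<in> spectrum A} (\<lambda>n. poly (p n)) g sequentially"
      "(\<lambda>n. poly_op (p n) A) \<longlonglongrightarrow> B"
  shows "fun_calc g A = B"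
  unfolding fun_calc_def
proof (rule the_equality)
  let ?S = "{x. complex_of_real x \<in> spectrum A}"
  show "\<exists>p. uniform_limit ?S (\<lambda>n. poly (p n)) g sequentially \<and> (\<lambda>n. poly_op (p n) A) \<longlonglongrightarrow> B"
    using p by blast
  fix B' assume "\<exists>p. uniform_limit ?S (\<lambda>n. poly (p n)) g sequentially \<and> (\<lambda>n. poly_op (p n) A) \<longlonglongrightarrow> B'"
  then obtain q where q: "uniform_limit ?S (\<lambda>n. poly (q n)) g sequentially"
    "(\<lambda>n. poly_op (q n) A) \<longlonglongrightarrow> B'" by blast
  have "(\<lambda>n. poly_op (q n) A - poly_op (p n) A) \<longlonglongrightarrow> 0"
  proof (rule tendstoI)
    fix e :: real assume e: "e > 0"
    have "\<forall>\<^sub>F n in sequentially. \<forall>x\<in>?S. dist (poly (q n) x) (g x) < e / 4"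
      "\<forall>\<^sub>F n in sequentially. \<forall>x\<in>?S. dist (poly (p n) x) (g x) < e / 4"
      using e uniform_limitD[OF q(1), of "e / 4"] uniform_limitD[OF p(1), of "e / 4"] by simp_all
    then show "\<forall>\<^sub>F n in sequentially. dist (poly_op (q n) A - poly_op (p n) A) 0 < e"
    proof eventually_elim
      case (elim n)
      have "norm (poly_op (q n - p n) A) \<le> e / 2"
      proof (rule norm_poly_op_le[OF assms(1)])
        fix x assume "complex_of_real x \<in> spectrum A"
        with elim have "dist (poly (q n) x) (g x) < e / 4" "dist (poly (p n) x) (g x) < e / 4"
          by auto
        then show "\<bar>poly (q n - p n) x\<bar> \<le> e / 2" by (simp add: dist_real_def abs_if split: if_splits)
      qed
      with e show ?case by (simp add: poly_op_diff)
    qed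
  qed
  with tendsto_diff[OF q(2) p(2)] show "B' = B"
    using LIMSEQ_unique by fastforce
qed

text \<open>The constant sequence \<open>[:0, 1:]\<close> equals \<open>g\<close> on the spectrum.
  In this way a bounded continuous function can reproduce the operator itself.\<close>

lemma fun_calc_id_on_spectrum:
  assumes "self_adjoint A" and "\<And>x. \<bar>x\<bar> \<le> norm A \<Longrightarrow> g x = x"
  shows "fun_calc g A = A"
proof (rule fun_calc_eqI[OF assms(1)])
  show "uniform_limit {x. complex_of_real x \<in> spectrum A} (\<lambda>n. poly [:0, 1:]) g sequentially"
    using assms(2) real_spectrum_bounded
    by (intro uniform_limitI always_eventually) (auto)
  have "poly_op [:0, 1:] A = A" by (rule blinfun_eqI) (simp add: blinfun.bilinear_simps)
  then show "(\<lambda>n. poly_op [:0, 1:] A) \<longlonglongrightarrow> A" by simp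
qed

text \<open>Approximating on a fixed interval that contains the real spectrum lets the same
  polynomials and the same error bound serve every self-adjoint operator of norm at most
  \<open>K\<close>; this uniformity later lets the limit pass through the average over
  \<omega>.\<close>

lemma
  assumes sa: "self_adjoint A" and K: "norm A \<le> K"
    and p: "uniform_limit {-K..K} (\<lambda>n. poly (p n)) g sequentially"
  shows fun_calc_limit: "(\<lambda>n. poly_op (p n) A) \<longlonglongrightarrow> fun_calc g A"
    and norm_fun_calc_diff_le: "(\<And>x. x \<in> {-K..K} \<Longrightarrow> \<bar>poly q x - g x\<bar> \<le> e)
        \<Longrightarrow> norm (poly_op q A - fun_calc g A) \<le> e"
proof -
  have spec: "x \<in> {-K..K}" if "complex_of_real x \<in> spectrum A" for x
    using real_spectrum_bounded[OF that] K by (auto simp: abs_le_iff)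
  have diff: "norm (poly_op q A - poly_op r A) \<le> s"
    if "\<And>x. x \<in> {-K..K} \<Longrightarrow> \<bar>poly q x - poly r x\<bar> \<le> s" for q r s
    using norm_poly_op_le[OF sa, of "q - r" s] that spec by (simp add: poly_op_diff)
  have "Cauchy (\<lambda>n. poly_op (p n) A)"
  proof (rule metric_CauchyI)
    fix e :: real assume e: "e > 0"
    then have "\<forall>\<^sub>F n in sequentially. \<forall>x\<in>{-K..K}. dist (poly (p n) x) (g x) < e / 4"
      using uniform_limitD[OF p, of "e / 4"] by simp
    then obtain N where N: "\<forall>n\<ge>N. \<forall>x\<in>{-K..K}. dist (poly (p n) x) (g x) < e / 4"
      unfolding eventually_sequentially by blast
    have "dist (poly_op (p m) A) (poly_op (p n) A) \<le> e / 2" if "m \<ge> N" "n \<ge> N" for m n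
      unfolding dist_norm
    proof (rule diff)
      fix x assume "x \<in> {-K..K}"
      with N[rule_format, OF that(1), of x] N[rule_format, OF that(2), of x] show "\<bar>poly (p m) x - poly (p n) x\<bar> \<le> e / 2"
        by (simp add: dist_real_def abs_if split: if_splits)
    qed
    with e show "\<exists>N. \<forall>m\<ge>N. \<forall>n\<ge>N. dist (poly_op (p m) A) (poly_op (p n) A) < e"
      by (intro exI[of _ N]) force
  qed
  then obtain B where B: "(\<lambda>n. poly_op (p n) A) \<longlonglongrightarrow> B"
    by (auto simp: Cauchy_convergent_iff convergent_def)
  have "fun_calc g A = B"
    using spec by (intro fun_calc_eqI[OF sa uniform_limit_on_subset[OF p] B]) auto
  with B show lim: "(\<lambda>n. poly_op (p n) A) \<longlonglongrightarrow> fun_calc g A" by simp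
  assume q: "\<And>x. x \<in> {-K..K} \<Longrightarrow> \<bar>poly q x - g x\<bar> \<le> e"
  show "norm (poly_op q A - fun_calc g A) \<le> e"
  proof (rule field_le_epsilon)
    fix d :: real assume d: "d > 0"
    show "norm (poly_op q A - fun_calc g A) \<le> e + d"
    proof (rule tendsto_upperbound)
      show "(\<lambda>n. norm (poly_op q A - poly_op (p n) A)) \<longlonglongrightarrow> norm (poly_op q A - fun_calc g A)"
        by (intro tendsto_intros lim)
      show "\<forall>\<^sub>F n in sequentially. norm (poly_op q A - poly_op (p n) A) \<le> e + d"
        using uniform_limitD[OF p d]
      proof eventually_elim
        case (elim n)
        show ?case
        proof (rule diff)
          fix x assume x: "x \<in> {-K..K}"
          with elim have "dist (poly (p n) x) (g x) < d" by blast
          with q[OF x] show "\<bar>poly q x - poly (p n) x\<bar> \<le> e + d"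
            unfolding dist_real_def by linarith
        qed
      qed
    qed simp
  qed
qed

section \<open>Measures from positive functionals\<close>

text \<open>Even powers are collected into a square of a polynomial \<open>r\<close>; as
  \<open>r(A)\<close> is self-adjoint, it is absorbed into the vector. What remains is one of
  \<open>1\<close>, \<open>K + A\<close>, \<open>K - A\<close>,
  \<open>K\<^sup>2 - A\<^sup>2\<close>, all nonnegative because
  \<open>norm A \<le> K\<close>.\<close>

lemma poly_op_factors_nonneg:
  assumes sa: "self_adjoint A" and K: "norm A \<le> K"
  shows "0 \<le> inner u (poly_op ([:K, 1:] ^ i * [:K, -1:] ^ j) A u)"
proof -
  let ?a = "[:K, 1:]" and ?b = "[:K, -1:]"
  have Au: "norm (A u) \<le> K * norm u" for u
    using norm_blinfun[of A u] mult_right_mono[OF K norm_ge_zero[of u]] by linarith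
  have uAu: "\<bar>inner u (A u)\<bar> \<le> K * inner u u" for u
    using Cauchy_Schwarz_ineq2[of u "A u"] mult_left_mono[OF Au[of u] norm_ge_zero[of u]]
    by (simp add: dot_square_norm power2_eq_square mult.left_commute)
  have AuAu: "inner (A u) (A u) \<le> K\<^sup>2 * inner u u" for u
    using power_mono[OF Au[of u], of 2] by (simp add: dot_square_norm power_mult_distrib)
  have base: "0 \<le> inner u (poly_op (?a ^ (i mod 2) * ?b ^ (j mod 2)) A u)" for u
  proof -
    have "inner u (A (A u)) = inner (A u) (A u)" using sa by (simp add: self_adjoint_def)
    moreover have "i mod 2 = 0 \<or> i mod 2 = 1" "j mod 2 = 0 \<or> j mod 2 = 1" by auto
    ultimately show ?thesis
      using uAu[of u] AuAu[of u]
      by (auto simp: one_pCons blinfun.add_right blinfun.scaleR_right blinfun.minus_right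
          inner_add_right inner_minus_right
          power2_eq_square algebra_simps abs_le_iff)
  qed
  define r where "r = ?a ^ (i div 2) * ?b ^ (j div 2)"
  have "c ^ n = c ^ (n div 2) * c ^ (n div 2) * c ^ (n mod 2)" for c :: "real poly" and n
    unfolding power_add[symmetric] by (rule arg_cong[where f = "\<lambda>n. c ^ n"]) presburger
  then have "?a ^ i * ?b ^ j = (?a ^ (i div 2) * ?a ^ (i div 2) * ?a ^ (i mod 2))
      * (?b ^ (j div 2) * ?b ^ (j div 2) * ?b ^ (j mod 2))" by metis
  also have "\<dots> = r * ((?a ^ (i mod 2) * ?b ^ (j mod 2)) * r)"
    unfolding r_def by (simp only: mult_ac)
  finally show ?thesis
    using base[of "poly_op r A u"] self_adjoint_poly_op[OF sa, of r]
    by (simp only: poly_op_mult_apply self_adjoint_def)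
qed

text \<open>The Bernstein basis transported from \<open>[0, 1]\<close> to \<open>[-K, K]\<close> by
  \<open>t = (x + K) / (2 * K)\<close>. Up to nonnegative constants its members are products of
  powers of \<open>K + x\<close> and \<open>K - x\<close>, a form whose positivity can be checked on
  operators.\<close>

definition bernstein_basis :: "real \<Rightarrow> nat \<Rightarrow> nat \<Rightarrow> real poly" where
  "bernstein_basis K n k = smult (real (n choose k) / (2 * K) ^ n) ([:K, 1:] ^ k * [:K, -1:] ^ (n - k))"

definition bernstein_poly :: "real \<Rightarrow> (real \<Rightarrow> real) \<Rightarrow> nat \<Rightarrow> real poly" where
  "bernstein_poly K g n
     = (\<Sum>k\<le>n. smult (g (2 * K * (real k / real n) - K)) (bernstein_basis K n k))"

lemma poly_bernstein_basis:
  assumes "K > 0" "k \<le> n"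
  shows "poly (bernstein_basis K n k) x = Bernstein n k ((x + K) / (2 * K))"
proof -
  have "1 - (x + K) / (2 * K) = (K - x) / (2 * K)" using assms by (simp add: field_simps)
  moreover have "(2 * K) ^ n = (2 * K) ^ k * (2 * K) ^ (n - k)"
    using assms(2) by (metis power_add le_add_diff_inverse)
  ultimately show ?thesis
    by (simp add: bernstein_basis_def Bernstein_def power_divide add.commute)
qed

lemma sum_bernstein_basis:
  assumes "K > 0"
  shows "(\<Sum>k\<le>n. bernstein_basis K n k) = 1"
proof -
  have "poly (\<Sum>k\<le>n. bernstein_basis K n k) = poly 1"
    using assms by (auto simp: poly_sum poly_bernstein_basis)
  then show ?thesis by (simp only: poly_eq_poly_eq_iff)
qed

lemma uniform_limit_bernstein_poly:
  assumes K: "K > 0" and g: "continuous_on UNIV g"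
  shows "uniform_limit {-K..K} (\<lambda>n. poly (bernstein_poly K g n)) g sequentially"
proof (rule uniform_limitI)
  fix e :: real assume e: "e > 0"
  define h where "h t = g (2 * K * t - K)" for t
  have "continuous_on {0..1} h"
    unfolding h_def by (intro continuous_on_compose2[OF g] continuous_intros) auto
  from Bernstein_Weierstrass[OF this e] obtain N where N:
    "\<And>n t. N \<le> n \<Longrightarrow> t \<in> {0..1} \<Longrightarrow> \<bar>h t - (\<Sum>k\<le>n. h (real k / real n) * Bernstein n k t)\<bar> < e"
    by blast
  have "dist (poly (bernstein_poly K g n) x) (g x) < e" if "n \<ge> N" "x \<in> {-K..K}" for n x
  proof -
    have t: "(x + K) / (2 * K) \<in> {0..1}" "h ((x + K) / (2 * K)) = g x"
      using that(2) K by (auto simp: h_def field_simps)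
    have "poly (bernstein_poly K g n) x = (\<Sum>k\<le>n. h (real k / real n) * Bernstein n k ((x + K) / (2 * K)))"
      using K by (simp add: bernstein_poly_def poly_sum poly_bernstein_basis h_def)
    with N[OF that(1) t(1)] t(2) show ?thesis by (simp add: dist_real_def abs_minus_commute)
  qed
  then show "\<forall>\<^sub>F n in sequentially. \<forall>x\<in>{-K..K}. dist (poly (bernstein_poly K g n) x) (g x) < e"
    unfolding eventually_sequentially by blast
qed

text \<open>
  The discrete measures with weights \<open>L (bernstein_basis K n k)\<close> integrate \<open>g\<close> to
  \<open>L (bernstein_poly K g n)\<close>; by Helly's theorem they have a weak limit point.
\<close>

lemma measure_of_positive_functional:
  fixes L :: "real poly \<Rightarrow> real"
  assumes K: "K > 0" and add: "\<And>p q. L (p + q) = L p + L q"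
    and smult: "\<And>c p. L (smult c p) = c * L p" and one: "L 1 = 1"
    and pos: "\<And>i j. 0 \<le> L ([:K, 1:] ^ i * [:K, -1:] ^ j)"
  shows "\<exists>\<kappa>. real_distribution \<kappa> \<and> (\<forall>g l. continuous_on UNIV g \<and> bounded (range g)
      \<and> (\<lambda>n. L (bernstein_poly K g n)) \<longlonglongrightarrow> l \<longrightarrow> (LINT x|\<kappa>. g x) = l)"
proof -
  have zero: "L 0 = 0" using smult[of 0 0] by simp
  have sum: "L (\<Sum>k\<in>S. p k) = (\<Sum>k\<in>S. L (p k))" for S and p :: "nat \<Rightarrow> real poly"
    by (induction S rule: infinite_finite_induct) (simp_all add: zero add)
  define w where "w n k = (if k \<le> n then L (bernstein_basis K n k) else 0)" for n k
  define node where "node n k = 2 * K * (real k / real n) - K" for n k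
  have w_nonneg: "0 \<le> w n k" for n k
    using pos K by (simp add: w_def bernstein_basis_def smult)
  have w_sum: "(\<Sum>k\<le>n. w n k) = 1" for n
  proof -
    have "(\<Sum>k\<le>n. w n k) = L (\<Sum>k\<le>n. bernstein_basis K n k)"
      unfolding sum by (intro sum.cong) (auto simp: w_def)
    then show ?thesis using K by (simp add: sum_bernstein_basis one)
  qed
  have w_int: "(\<integral>\<^sup>+k. ennreal (w n k) \<partial>count_space UNIV) = 1" for n
  proof -
    have "(\<integral>\<^sup>+k. ennreal (w n k) \<partial>count_space UNIV) = (\<Sum>k\<le>n. ennreal (w n k))"
      by (rule nn_integral_count_space') (auto simp: w_def)
    then show ?thesis using w_nonneg w_sum by (simp add: sum_ennreal)
  qed
  define P where "P n = embed_pmf (w n)" for n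
  have P: "pmf (P n) k = w n k" for n k
    unfolding P_def by (rule pmf_embed_pmf[OF w_nonneg w_int])
  define \<mu> where "\<mu> n = distr (measure_pmf (P n)) borel (node n)" for n
  have set: "set_pmf (P n) \<subseteq> {..n}" for n
    by (auto simp: set_pmf_iff P w_def split: if_splits)
  have int: "(LINT x|\<mu> n. g x) = L (bernstein_poly K g n)" if "g \<in> borel_measurable borel" for g n
  proof -
    have "(LINT x|\<mu> n. g x) = (LINT k|measure_pmf (P n). g (node n k))"
      unfolding \<mu>_def using that by (intro integral_distr) auto
    also have "\<dots> = (\<Sum>k\<le>n. g (node n k) * pmf (P n) k)"
      using set by (intro integral_measure_pmf_real) auto
    also have "\<dots> = L (bernstein_poly K g n)"
      unfolding bernstein_poly_def sum P smult by (intro sum.cong) (auto simp: w_def node_def)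
    finally show ?thesis .
  qed
  have distr: "real_distribution (\<mu> n)" for n
    unfolding \<mu>_def by (rule prob_space.real_distribution_distr) (auto intro: measure_pmf.prob_space_axioms)
  have "tight \<mu>"
    unfolding tight_def
  proof (intro conjI allI impI distr)
    fix e :: real assume e: "e > 0"
    \<comment> \<open>All nodes lie in \<open>[-K, K]\<close>. Tightness is phrased with left-open
      intervals and \<open>- K\<close> is itself a node, hence the left end
      \<open>- K - 1\<close>.\<close>
    have "measure (\<mu> n) {- K - 1<..K} = 1" for n
    proof -
      have "node n k \<in> {- K - 1<..K}" if "k \<le> n" for k
      proof -
        define t where "t = real k / real n"
        have "0 \<le> t" "t \<le> 1" using that by (auto simp: t_def divide_le_eq_1)
        then have "0 \<le> K * t" "K * t \<le> K"
          using K mult_left_mono[of t 1 K] by auto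
        then show ?thesis using K by (simp add: node_def flip: t_def)
      qed
      then have "AE k in measure_pmf (P n). k \<in> node n -` {- K - 1<..K}"
        using set by (auto simp: AE_measure_pmf_iff)
      then have "measure (measure_pmf (P n)) (node n -` {- K - 1<..K}) = 1"
        by (subst measure_pmf.prob_eq_1) auto
      then show ?thesis unfolding \<mu>_def by (subst measure_distr) auto
    qed
    then show "\<exists>a b. a < b \<and> (\<forall>n. 1 - e < measure (\<mu> n) {a<..b})"
      using e K by (intro exI[of _ "- K - 1"] exI[of _ K]) auto
  qed
  from tight_imp_convergent_subsubsequence[OF this, of "\<lambda>n. n"]
  obtain r \<kappa> where r: "strict_mono r" and \<kappa>: "real_distribution \<kappa>"
    and conv: "weak_conv_m (\<lambda>n. \<mu> (r n)) \<kappa>"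
    by (auto simp: strict_mono_def comp_def)
  have "(LINT x|\<kappa>. g x) = l"
    if g: "continuous_on UNIV g" "bounded (range g)" and l: "(\<lambda>n. L (bernstein_poly K g n)) \<longlonglongrightarrow> l" for g l
  proof -
    obtain C where C: "\<And>x. norm (g x) \<le> C" using g(2) by (auto simp: bounded_iff)
    have "(\<lambda>n. LINT x|\<mu> (r n). g x) \<longlonglongrightarrow> (LINT x|\<kappa>. g x)"
      using g(1) by (intro weak_conv_imp_integral_bdd_continuous_conv[OF distr \<kappa> conv _ C])
        (simp add: continuous_on_eq_continuous_at)
    moreover have "g \<in> borel_measurable borel" using g(1) by (rule borel_measurable_continuous_onI)
    ultimately have "(\<lambda>n. L (bernstein_poly K g (r n))) \<longlonglongrightarrow> (LINT x|\<kappa>. g x)" by (simp add: int)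
    \<comment> \<open>The full sequence converges for such \<open>g\<close>, so the subsequence
      determines the integral; it is chosen before \<open>g\<close>, and therefore one
      \<open>\<kappa>\<close> serves all \<open>g\<close>.\<close>
    moreover have "(\<lambda>n. L (bernstein_poly K g (r n))) \<longlonglongrightarrow> l"
      using LIMSEQ_subseq_LIMSEQ[OF l r] by (simp add: comp_def)
    ultimately show ?thesis by (rule LIMSEQ_unique)
  qed
  with \<kappa> show ?thesis by blast
qed

section \<open>Averaged spectral measures\<close>

text \<open>Two isometric shifts and a multiplication by at most \<open>C\<close>. The bound depends
  on \<open>v\<close> only through \<open>C\<close>, so one interval contains the real spectra of a
  whole family of operators.\<close>

lemma norm_schroedinger_le:
  assumes v: "\<And>n. \<bar>v n\<bar> \<le> C"
  shows "norm (schroedinger v) \<le> 2 + C"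
proof (rule norm_blinfun_bound)
  have C: "0 \<le> C" using v[of 0] by linarith
  then show "0 \<le> 2 + C" by simp
  fix u
  obtain w1 where w1: "ell2_nth w1 = (\<lambda>n. ell2_nth u (n + -1))" "norm w1 = norm u"
    using norm_shift_ell2 by blast
  obtain w2 where w2: "ell2_nth w2 = (\<lambda>n. ell2_nth u (n + 1))" "norm w2 = norm u"
    using norm_shift_ell2 by blast
  define w3 where "w3 = schroedinger v u - w1 - w2"
  have w3: "ell2_nth w3 n = complex_of_real (v n) * ell2_nth u n" for n
    by (simp add: w3_def schroedinger_apply[OF v] w1 w2)
  have "(norm w3)\<^sup>2 \<le> (\<Sum>\<^sub>\<infinity>n. C\<^sup>2 * (cmod (ell2_nth u n))\<^sup>2)"
    unfolding norm_ell2_square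
  proof (rule infsum_mono)
    show "(\<lambda>n. C\<^sup>2 * (cmod (ell2_nth u n))\<^sup>2) summable_on UNIV"
      by (intro summable_on_cmult_right ell2_nth_square_summable)
    show "(cmod (ell2_nth w3 n))\<^sup>2 \<le> C\<^sup>2 * (cmod (ell2_nth u n))\<^sup>2" for n
      using power_mono[OF v[of n], of 2]
      by (simp add: w3 norm_mult power_mult_distrib mult_right_mono)
  qed (rule ell2_nth_square_summable)
  then have "(norm w3)\<^sup>2 \<le> (C * norm u)\<^sup>2"
    by (simp add: infsum_cmult_right' norm_ell2_square power_mult_distrib)
  then have "norm w3 \<le> C * norm u"
    by (rule power2_le_imp_le) (simp add: C)
  moreover have "schroedinger v u = w1 + w2 + w3" by (simp add: w3_def)
  ultimately show "norm (schroedinger v u) \<le> (2 + C) * norm u"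
    using norm_triangle_ineq[of "w1 + w2" w3] norm_triangle_ineq[of w1 w2] w1(2) w2(2)
    by (simp add: algebra_simps)
qed

lemma self_adjoint_schroedinger:
  assumes "\<And>n. \<bar>v n\<bar> \<le> C"
  shows "self_adjoint (schroedinger v)"
  using schroedinger_self_adjoint[OF assms] by (simp add: self_adjoint_def inner_ell2_def)

lemma bounded_linear_ell2_nth: "bounded_linear (\<lambda>x. ell2_nth x k)"
  by (rule bounded_linear_intro[where K = 1]) (simp_all add: norm_ell2_nth_le)

text \<open>Real coefficients and a real potential keep the real vector \<open>ell2_basis 0\<close>
  real. In the limit the diagonal elements of \<open>g(H)\<close> are real too, so a real functional
  captures them.\<close>

lemma Im_poly_op_schroedinger:
  assumes "\<And>n. \<bar>v n\<bar> \<le> C"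
  shows "Im (ell2_nth (poly_op p (schroedinger v) (ell2_basis 0)) n) = 0"
  by (induction p arbitrary: n) (simp_all add: schroedinger_apply[OF assms])

text \<open>Each application of the operator couples only neighbouring coordinates, so a coordinate
  of the vector is a polynomial expression in finitely many of the functions
  \<open>v \<omega> k\<close>.\<close>

lemma measurable_poly_op_schroedinger:
  assumes v: "\<And>\<omega> n. \<bar>v \<omega> n\<bar> \<le> C" and [measurable]: "\<And>n. (\<lambda>\<omega>. v \<omega> n) \<in> borel_measurable M"
  shows "(\<lambda>\<omega>. ell2_nth (poly_op p (schroedinger (v \<omega>)) (ell2_basis 0)) n) \<in> borel_measurable M"
proof (induction p arbitrary: n)
  case (pCons a p)
  note pCons.IH[measurable]
  show ?case by (simp add: schroedinger_apply[OF v])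
qed simp

text \<open>The positive functional is the average over \<open>F\<close> of the diagonal element of
  \<open>p(A \<omega>)\<close> at \<open>ell2_basis 0\<close>. The conclusion covers all bounded
  continuous \<open>g\<close>, since the truncated identity that tests the first moment has no
  compact support.\<close>

lemma averaged_spectral_measure:
  fixes v :: "'a \<Rightarrow> int \<Rightarrow> real"
  assumes F: "F \<in> sets M" "0 < emeasure M F" "emeasure M F < \<infinity>"
    and v: "\<And>\<omega> n. \<bar>v \<omega> n\<bar> \<le> C" and meas: "\<And>n. (\<lambda>\<omega>. v \<omega> n) \<in> borel_measurable M"
  shows "\<exists>\<kappa>. real_distribution \<kappa> \<and> (\<forall>g :: real \<Rightarrow> real. continuous_on UNIV g \<and> bounded (range g) \<longrightarrow>
       set_integrable M F
         (\<lambda>\<omega>. cinner (ell2_basis 0) (fun_calc g (schroedinger (v \<omega>)) (ell2_basis 0))) \<and>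
       complex_of_real (LINT E|\<kappa>. g E) = complex_of_real (1 / measure M F) *
         (LINT \<omega>:F|M. cinner (ell2_basis 0)
            (fun_calc g (schroedinger (v \<omega>)) (ell2_basis 0))))"
proof -
  define A where "A \<omega> = schroedinger (v \<omega>)" for \<omega>
  define K where "K = 2 + C"
  define m where "m = measure M F"
  define s where "s B = Re (ell2_nth (blinfun_apply B (ell2_basis 0)) 0)" for B
  define L where "L p = (1 / m) * (LINT \<omega>:F|M. s (poly_op p (A \<omega>)))" for p
  have K: "K > 0" using abs_ge_zero[of "v undefined 0"] v[of "undefined :: 'a" "0 :: int"] unfolding K_def by linarith
  have m: "m > 0" using F by (simp add: m_def measure_def enn2real_positive_iff)
  have sa: "self_adjoint (A \<omega>)" and nA: "norm (A \<omega>) \<le> K" for \<omega>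
    unfolding A_def K_def using self_adjoint_schroedinger norm_schroedinger_le v by blast+
  have s_inner: "s B = inner (ell2_basis 0) (B (ell2_basis 0))" for B
    by (simp add: s_def inner_ell2_def cinner_basis_left)
  have s_le: "\<bar>s B\<bar> \<le> norm B" for B
    using Cauchy_Schwarz_ineq2[of "ell2_basis 0" "B (ell2_basis 0)"] norm_blinfun[of B "ell2_basis 0"]
    by (simp add: s_inner)
  have s_diff: "s (B - B') = s B - s B'" for B B'
    by (simp add: s_def blinfun.diff_left)
  have s_meas: "(\<lambda>\<omega>. s (poly_op p (A \<omega>))) \<in> borel_measurable M" for p
    using measurable_poly_op_schroedinger[OF v meas, where p = p and n = 0] by (simp add: s_def A_def)
  have integrable: "set_integrable M F h"
    if "h \<in> borel_measurable M" "\<And>\<omega>. \<bar>h \<omega>\<bar> \<le> b" for h :: "'a \<Rightarrow> real" and b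
    unfolding set_integrable_def using that F
    by (intro integrableI_bounded_set_indicator[where B = b]) auto
  have s_int: "set_integrable M F (\<lambda>\<omega>. s (poly_op p (A \<omega>)))" for p
  proof -
    have "bounded (poly p ` {-K..K})"
      by (intro compact_imp_bounded compact_continuous_image continuous_intros) auto
    then have "\<exists>b. \<forall>x\<in>{-K..K}. \<bar>poly p x\<bar> \<le> b"
      by (simp add: bounded_iff)
    then obtain b where b: "\<And>x. x \<in> {-K..K} \<Longrightarrow> \<bar>poly p x\<bar> \<le> b" by blast
    have "norm (poly_op p (A \<omega>)) \<le> b" for \<omega>
    proof (rule norm_poly_op_le[OF sa])
      fix x assume "complex_of_real x \<in> spectrum (A \<omega>)"
      then have "\<bar>x\<bar> \<le> K" using real_spectrum_bounded nA order_trans by blast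
      then show "\<bar>poly p x\<bar> \<le> b" by (intro b) (auto simp: abs_le_iff)
    qed
    then show ?thesis by (intro integrable[OF s_meas, where b = b] order_trans[OF s_le])
  qed
  have "\<exists>\<kappa>. real_distribution \<kappa> \<and> (\<forall>g l. continuous_on UNIV g \<and> bounded (range g)
      \<and> (\<lambda>n. L (bernstein_poly K g n)) \<longlonglongrightarrow> l \<longrightarrow> (LINT x|\<kappa>. g x) = l)"
  proof (rule measure_of_positive_functional[OF K])
    show "L (p + q) = L p + L q" for p q
      unfolding L_def poly_op_add
      using set_integral_add(2)[OF s_int[of p] s_int[of q]]
      by (simp add: s_def blinfun.add_left distrib_left)
    show "L (smult c p) = c * L p" for c p
      by (simp add: L_def poly_op_smult s_def blinfun.scaleR_left)
    have "poly_op 1 B = id_blinfun" for B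
      by (rule blinfun_eqI) (simp add: one_pCons blinfun.bilinear_simps)
    then show "L 1 = 1"
      using m F by (simp add: L_def s_def set_integral_const m_def)
    show "0 \<le> L ([:K, 1:] ^ i * [:K, -1:] ^ j)" for i j
      unfolding L_def set_lebesgue_integral_def s_inner using m poly_op_factors_nonneg[OF sa nA]
      by (intro mult_nonneg_nonneg integral_nonneg_AE) auto
  qed
  then obtain \<kappa> where \<kappa>: "real_distribution \<kappa>"
    and \<kappa>_int: "\<And>g l. continuous_on UNIV g \<Longrightarrow> bounded (range g)
      \<Longrightarrow> (\<lambda>n. L (bernstein_poly K g n)) \<longlonglongrightarrow> l \<Longrightarrow> (LINT x|\<kappa>. g x) = l"
    by blast
  show ?thesis
  proof (intro exI[of _ \<kappa>] conjI \<kappa> allI impI; elim conjE)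
    fix g :: "real \<Rightarrow> real" assume g: "continuous_on UNIV g" "bounded (range g)"
    note ul = uniform_limit_bernstein_poly[OF K g(1)]
    have lim: "(\<lambda>n. poly_op (bernstein_poly K g n) (A \<omega>)) \<longlonglongrightarrow> fun_calc g (A \<omega>)" for \<omega>
      using fun_calc_limit[OF sa nA ul] .
    have nth_lim: "(\<lambda>n. ell2_nth (poly_op (bernstein_poly K g n) (A \<omega>) (ell2_basis 0)) 0)
        \<longlonglongrightarrow> ell2_nth (fun_calc g (A \<omega>) (ell2_basis 0)) 0" for \<omega>
      by (intro bounded_linear.tendsto[OF bounded_linear_ell2_nth] blinfun.tendsto lim tendsto_const)
    have s_lim: "(\<lambda>n. s (poly_op (bernstein_poly K g n) (A \<omega>))) \<longlonglongrightarrow> s (fun_calc g (A \<omega>))" for \<omega>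
      unfolding s_def by (intro tendsto_Re nth_lim)
    have "(\<lambda>n. Im (ell2_nth (poly_op (bernstein_poly K g n) (A \<omega>) (ell2_basis 0)) 0))
        \<longlonglongrightarrow> Im (ell2_nth (fun_calc g (A \<omega>) (ell2_basis 0)) 0)" for \<omega>
      by (intro tendsto_Im nth_lim)
    then have "Im (ell2_nth (fun_calc g (A \<omega>) (ell2_basis 0)) 0) = 0" for \<omega>
      unfolding A_def Im_poly_op_schroedinger[OF v] by (simp add: LIMSEQ_const_iff)
    then have cinner_eq: "cinner (ell2_basis 0) (fun_calc g (A \<omega>) (ell2_basis 0))
        = complex_of_real (s (fun_calc g (A \<omega>)))" for \<omega>
      by (simp add: cinner_basis_left s_def complex_eq_iff)
    have sg_meas: "(\<lambda>\<omega>. s (fun_calc g (A \<omega>))) \<in> borel_measurable M"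
      by (rule borel_measurable_LIMSEQ_real[OF s_lim s_meas])
    \<comment> \<open>\<open>N\<close> is independent of \<omega>. This uniform closeness yields
      both integrability over the set \<open>F\<close> of finite measure and the exchange of limit
      and integral.\<close>
    have close: "\<exists>N. \<forall>n\<ge>N. \<forall>\<omega>. \<bar>s (poly_op (bernstein_poly K g n) (A \<omega>)) - s (fun_calc g (A \<omega>))\<bar> \<le> e"
      if e: "e > 0" for e
    proof -
      obtain N where N: "\<forall>n\<ge>N. \<forall>x\<in>{-K..K}. dist (poly (bernstein_poly K g n) x) (g x) < e"
        using uniform_limitD[OF ul e] unfolding eventually_sequentially by blast
      show ?thesis
      proof (intro exI[of _ N] allI impI)
        fix n \<omega> assume n: "n \<ge> N"
        have "norm (poly_op (bernstein_poly K g n) (A \<omega>) - fun_calc g (A \<omega>)) \<le> e"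
          using N[rule_format, OF n]
          by (intro norm_fun_calc_diff_le[OF sa nA ul]) (auto simp: dist_real_def intro: less_imp_le)
        then show "\<bar>s (poly_op (bernstein_poly K g n) (A \<omega>)) - s (fun_calc g (A \<omega>))\<bar> \<le> e"
          using s_le order_trans unfolding s_diff[symmetric] by blast
      qed
    qed
    have sg_int: "set_integrable M F (\<lambda>\<omega>. s (fun_calc g (A \<omega>)))"
    proof -
      obtain N where N: "\<forall>n\<ge>N. \<forall>\<omega>. \<bar>s (poly_op (bernstein_poly K g n) (A \<omega>)) - s (fun_calc g (A \<omega>))\<bar> \<le> 1"
        using close[of 1, OF zero_less_one] by blast
      have "set_integrable M F (\<lambda>\<omega>. s (poly_op (bernstein_poly K g N) (A \<omega>)) - s (fun_calc g (A \<omega>)))"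
        using N s_meas sg_meas by (intro integrable[where b = 1] borel_measurable_diff) auto
      from set_integral_diff(1)[OF s_int[of "bernstein_poly K g N"] this] show ?thesis by simp
    qed
    have "(\<lambda>n. L (bernstein_poly K g n)) \<longlonglongrightarrow> (1 / m) * (LINT \<omega>:F|M. s (fun_calc g (A \<omega>)))"
    proof (rule LIMSEQ_I)
      fix e :: real assume e: "e > 0"
      obtain N where N: "\<forall>n\<ge>N. \<forall>\<omega>. \<bar>s (poly_op (bernstein_poly K g n) (A \<omega>)) - s (fun_calc g (A \<omega>))\<bar> \<le> e / 2"
        using close[OF half_gt_zero[OF e]] by blast
      have "norm (L (bernstein_poly K g n) - (1 / m) * (LINT \<omega>:F|M. s (fun_calc g (A \<omega>)))) < e"
        if n: "n \<ge> N" for n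
      proof -
        let ?d = "\<lambda>\<omega>. s (poly_op (bernstein_poly K g n) (A \<omega>)) - s (fun_calc g (A \<omega>))"
        have d: "set_integrable M F ?d" by (rule set_integral_diff(1)[OF s_int sg_int])
        have "\<bar>LINT \<omega>:F|M. ?d \<omega>\<bar> \<le> (LINT \<omega>:F|M. \<bar>?d \<omega>\<bar>)"
          using set_integral_norm_bound[OF d] by simp
        also have "\<dots> \<le> (LINT \<omega>:F|M. e / 2)"
          using N n F by (intro set_integral_mono set_integrable_abs d integrable[where b = "e / 2"]) (use e in auto)
        also have "\<dots> = m * (e / 2)"
          using F by (simp add: set_integral_const m_def)
        also have "\<dots> < m * e" using m e by simp
        finally have "\<bar>LINT \<omega>:F|M. ?d \<omega>\<bar> < m * e" .
        then have "\<bar>(1 / m) * (LINT \<omega>:F|M. ?d \<omega>)\<bar> < e"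
          using m by (simp add: abs_mult field_simps)
        then show ?thesis
          by (simp add: L_def set_integral_diff(2)[OF s_int sg_int] right_diff_distrib diff_divide_distrib)
      qed
      then show "\<exists>N. \<forall>n\<ge>N. norm (L (bernstein_poly K g n) - (1 / m) * (LINT \<omega>:F|M. s (fun_calc g (A \<omega>)))) < e"
        by blast
    qed
    from \<kappa>_int[OF g this]
    show "complex_of_real (LINT E|\<kappa>. g E) = complex_of_real (1 / measure M F) *
         (LINT \<omega>:F|M. cinner (ell2_basis 0) (fun_calc g (schroedinger (v \<omega>)) (ell2_basis 0)))"
      unfolding A_def[symmetric] cinner_eq set_integral_complex_of_real m_def by simp
    have "integrable M (\<lambda>\<omega>. complex_of_real (indicator F \<omega> *\<^sub>R s (fun_calc g (A \<omega>))))"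
      using sg_int unfolding set_integrable_def by (rule integrable_of_real)
    then show "set_integrable M F
         (\<lambda>\<omega>. cinner (ell2_basis 0) (fun_calc g (schroedinger (v \<omega>)) (ell2_basis 0)))"
      unfolding A_def[symmetric] cinner_eq set_integrable_def by (simp add: scaleR_conv_of_real)
  qed
qed

section \<open>The tower as a counterexample\<close>

lemma measurable_int_iterate:
  assumes "invertible_transformation M T"
  shows "int_iterate (space M) T n \<in> measurable M M"
  using assms by (cases "0 \<le> n")
    (simp_all add: invertible_transformation_def int_iterate_def measurable_compose_n)

lemma bounded_range_compact_support:
  fixes g :: "'a::topological_space \<Rightarrow> 'b::real_normed_vector"
  assumes "continuous_on UNIV g" "compact (closure {x. g x \<noteq> 0})"
  shows "bounded (range g)"
proof -
  have "compact (g ` closure {x. g x \<noteq> 0})"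
    using assms continuous_on_subset by (blast intro: compact_continuous_image)
  then have "bounded (insert 0 (g ` closure {x. g x \<noteq> 0}))"
    by (simp add: compact_imp_bounded)
  then show ?thesis
    by (rule bounded_subset) (use closure_subset[of "{x. g x \<noteq> 0}"] in auto)
qed

theorem theorem5p2:
  shows "\<exists>(M :: real measure) (T :: real \<Rightarrow> real) (f :: real \<Rightarrow> real)
      (F :: nat \<Rightarrow> real set) (\<kappa> :: nat \<Rightarrow> real measure).
    sigma_finite_measure M \<and> emeasure M (space M) = \<infinity> \<and>
    invertible_transformation M T \<and>
    measure_preserving_transformation M T \<and>
    ergodic_transformation M T \<and>
    conservative_transformation M T \<and>
    f \<in> borel_measurable M \<and> (\<exists>C. \<forall>\<omega>\<in>space M. \<bar>f \<omega>\<bar> \<le> C) \<and>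
    (\<forall>l. F l \<in> sets M \<and> 0 < emeasure M (F l) \<and> emeasure M (F l) < \<infinity>) \<and>
    incseq F \<and> (\<Union>l. F l) = space M \<and>
    (\<forall>l. prob_space (\<kappa> l) \<and> sets (\<kappa> l) = sets borel) \<and>
    (\<forall>l. \<forall>g :: real \<Rightarrow> real.
       continuous_on UNIV g \<and> compact (closure {x. g x \<noteq> 0}) \<longrightarrow>
       set_integrable M (F l)
         (\<lambda>\<omega>. cinner (ell2_basis 0) (fun_calc g (orbit_operator M T f \<omega>) (ell2_basis 0))) \<and>
       complex_of_real (LINT E|\<kappa> l. g E) =
         complex_of_real (1 / measure M (F l)) *
         (LINT \<omega>:F l|M. cinner (ell2_basis 0)
            (fun_calc g (orbit_operator M T f \<omega>) (ell2_basis 0)))) \<and>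
    \<not> (\<exists>\<nu>. finite_measure \<nu> \<and> sets \<nu> = sets borel \<and> weakly_converges \<kappa> \<nu>)"
proof -
  obtain \<alpha> :: real where \<alpha>: "\<alpha> \<notin> \<rat>"
    using uncountable_UNIV_real countable_rat by (metis UNIV_eq_I)
  define T where "T = tower_map \<alpha>"
  let ?M = tower_measure
  define A where "A n = {y \<in> tower. \<lfloor>y\<rfloor> mod 2 = 0 \<and> y < real n}" for n
  define B where "B n = {y \<in> tower. \<lfloor>y\<rfloor> mod 2 = 1 \<and> y < real n}" for n
  have UA: "(\<Union>n. A n) = {y \<in> tower. \<lfloor>y\<rfloor> mod 2 = 0}"
    and UB: "(\<Union>n. B n) = {y \<in> tower. \<lfloor>y\<rfloor> mod 2 = 1}"
    using reals_Archimedean2 by (auto simp: A_def B_def)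
  have sets: "A n \<in> sets ?M" "B n \<in> sets ?M" for n
  proof -
    have "A n \<in> sets borel" "B n \<in> sets borel" unfolding A_def B_def by measurable
    then show "A n \<in> sets ?M" "B n \<in> sets ?M" by (auto simp: sets_tower_measure A_def B_def)
  qed
  have fin: "emeasure ?M S < \<infinity>" if "S \<subseteq> tower" "\<And>y. y \<in> S \<Longrightarrow> y < real n" for S n
  proof -
    have "S \<subseteq> {0..real n}" using that tower_nonneg by (force intro: less_imp_le)
    then have "emeasure lborel S \<le> emeasure lborel {0..real n}" by (intro emeasure_mono) auto
    then show ?thesis using that by (auto simp: emeasure_tower_measure intro: le_less_trans)
  qed
  have inc: "incseq A" "incseq B" by (auto simp: incseq_def A_def B_def)
  have finite: "emeasure ?M (A n) < \<infinity>" "emeasure ?M (B n) < \<infinity>" for n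
    by (rule fin[of _ n]; auto simp: A_def B_def)+
  have inf: "emeasure ?M (\<Union>n. A n) = \<infinity>" "emeasure ?M (\<Union>n. B n) = \<infinity>"
    unfolding UA UB using emeasure_tower_residue_class[of 0] emeasure_tower_residue_class[of 1]
    by (subst emeasure_tower_measure; auto)+
  have disj: "(\<Union>n. A n) \<inter> (\<Union>n. B n) = {}" unfolding UA UB by auto
  obtain F where incF: "incseq F"
    and F: "\<forall>l. F l \<in> sets ?M \<and> 0 < emeasure ?M (F l) \<and> emeasure ?M (F l) < \<infinity>"
    and UF: "(\<Union>l. F l) = (\<Union>n. A n) \<union> (\<Union>n. B n)"
    and osc: "\<forall>l. even l \<longrightarrow> 3 / 4 \<le> measure ?M (F l \<inter> (\<Union>n. A n)) / measure ?M (F l)"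
      "\<forall>l. odd l \<longrightarrow> measure ?M (F l \<inter> (\<Union>n. A n)) / measure ?M (F l) \<le> 1 / 4"
    by (rule oscillating_exhaustion[OF inc(1) sets(1) finite(1) inf(1) inc(2) sets(2) finite(2) inf(2) disj])
  define f :: "real \<Rightarrow> real" where "f = indicator (\<Union>n. A n)"
  have f: "f \<in> borel_measurable ?M"
    unfolding f_def using sets(1) by (intro borel_measurable_indicator sets.countable_UN) auto
  have f_le: "\<bar>f \<omega>\<bar> \<le> 1" for \<omega> by (simp add: f_def indicator_def)
  define v where "v \<omega> n = f (int_iterate tower T n \<omega>)" for \<omega> n
  have v_le: "\<bar>v \<omega> n\<bar> \<le> 1" for \<omega> n by (simp add: v_def f_le)
  have H: "orbit_operator ?M T f \<omega> = schroedinger (v \<omega>)" for \<omega>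
    by (simp add: orbit_operator_def v_def[abs_def])
  have v_meas: "(\<lambda>\<omega>. v \<omega> n) \<in> borel_measurable ?M" for n
    using measurable_compose[OF measurable_int_iterate[OF invertible_tower_map[of \<alpha>]] f, of n]
    by (simp add: v_def T_def)
  define averaged where "averaged l \<kappa> \<longleftrightarrow> (\<forall>g :: real \<Rightarrow> real. continuous_on UNIV g \<and> bounded (range g) \<longrightarrow>
       set_integrable ?M (F l)
         (\<lambda>\<omega>. cinner (ell2_basis 0) (fun_calc g (schroedinger (v \<omega>)) (ell2_basis 0))) \<and>
       complex_of_real (LINT E|\<kappa>. g E) = complex_of_real (1 / measure ?M (F l)) *
         (LINT \<omega>:F l|?M. cinner (ell2_basis 0)
            (fun_calc g (schroedinger (v \<omega>)) (ell2_basis 0))))" for l \<kappa>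
  have "\<exists>\<kappa>. real_distribution \<kappa> \<and> averaged l \<kappa>" for l
    unfolding averaged_def using F by (intro averaged_spectral_measure[OF _ _ _ v_le v_meas]) simp_all
  then obtain \<kappa> where \<kappa>: "\<And>l. real_distribution (\<kappa> l)" and "\<And>l. averaged l (\<kappa> l)"
    by metis
  then have \<kappa>_int: "set_integrable ?M (F l)
         (\<lambda>\<omega>. cinner (ell2_basis 0) (fun_calc g (schroedinger (v \<omega>)) (ell2_basis 0)))"
      "complex_of_real (LINT E|\<kappa> l. g E) = complex_of_real (1 / measure ?M (F l)) *
         (LINT \<omega>:F l|?M. cinner (ell2_basis 0)
            (fun_calc g (schroedinger (v \<omega>)) (ell2_basis 0)))"
    if "continuous_on UNIV g" "bounded (range g)" for l and g :: "real \<Rightarrow> real"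
    using that unfolding averaged_def by blast+
  have not_weak: "\<not> weakly_converges \<kappa> \<nu>" for \<nu>
  proof
    assume weak: "weakly_converges \<kappa> \<nu>"
    \<comment> \<open>The cutoff 3 is the norm bound \<open>2 + C\<close> for a potential bounded by
      \<open>C = 1\<close>, so \<open>g\<close> is the identity on all the real spectra.\<close>
    define g :: "real \<Rightarrow> real" where "g x = max (- 3) (min 3 x)" for x
    have g: "continuous_on UNIV g" "bounded (range g)"
    proof -
      show "continuous_on UNIV g" unfolding g_def by (intro continuous_intros)
      show "bounded (range g)" by (rule boundedI[of _ 3]) (auto simp: g_def)
    qed
    have "fun_calc g (schroedinger (v \<omega>)) = schroedinger (v \<omega>)" for \<omega>
    proof (rule fun_calc_id_on_spectrum[OF self_adjoint_schroedinger[OF v_le]])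
      show "g x = x" if "\<bar>x\<bar> \<le> norm (schroedinger (v \<omega>))" for x
        using that norm_schroedinger_le[of "v \<omega>" 1, OF v_le] by (auto simp: g_def)
    qed
    \<comment> \<open>The neighbours of site 0 contribute nothing at \<open>ell2_basis 0\<close>,
      which leaves the potential at 0, and the zeroth iterate is \<omega> itself.\<close>
    then have "cinner (ell2_basis 0) (fun_calc g (schroedinger (v \<omega>)) (ell2_basis 0))
        = complex_of_real (f \<omega>)" for \<omega>
      by (simp add: cinner_basis_left schroedinger_apply[OF v_le]) (simp add: v_def int_iterate_def)
    moreover have "(LINT \<omega>:F l|?M. f \<omega>) = measure ?M (F l \<inter> (\<Union>n. A n))" for l
    proof -
      have "(LINT \<omega>:F l|?M. f \<omega>) = integral\<^sup>L ?M (indicator (F l \<inter> (\<Union>n. A n)))"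
        unfolding set_lebesgue_integral_def f_def
        by (intro Bochner_Integration.integral_cong) (auto simp: indicator_def)
      also have "\<dots> = measure ?M (F l \<inter> (\<Union>n. A n) \<inter> space ?M)" by (rule Bochner_Integration.integral_indicator)
      also have "F l \<inter> (\<Union>n. A n) \<inter> space ?M = F l \<inter> (\<Union>n. A n)"
        by (auto simp: A_def)
      finally show ?thesis .
    qed
    ultimately have "complex_of_real (LINT E|\<kappa> l. g E)
        = complex_of_real (measure ?M (F l \<inter> (\<Union>n. A n)) / measure ?M (F l))" for l
      using \<kappa>_int(2)[OF g, of l] by (simp add: set_integral_complex_of_real)
    then have avg: "(LINT E|\<kappa> l. g E) = measure ?M (F l \<inter> (\<Union>n. A n)) / measure ?M (F l)" for l
      by (simp only: of_real_eq_iff)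
    have lim: "(\<lambda>l. LINT E|\<kappa> l. g E) \<longlonglongrightarrow> (LINT E|\<nu>. g E)"
      using weak g by (simp add: weakly_converges_def)
    have "3 / 4 \<le> (LINT E|\<nu>. g E)"
    proof (rule LIMSEQ_le_const[OF LIMSEQ_subseq_LIMSEQ[OF lim, of "\<lambda>l. 2 * l"]])
      show "\<exists>N. \<forall>n\<ge>N. 3 / 4 \<le> ((\<lambda>l. LINT E|\<kappa> l. g E) \<circ> (\<lambda>l. 2 * l)) n"
        using osc(1) by (simp add: avg)
    qed (simp add: strict_mono_def)
    moreover have "(LINT E|\<nu>. g E) \<le> 1 / 4"
    proof (rule LIMSEQ_le_const2[OF LIMSEQ_subseq_LIMSEQ[OF lim, of "\<lambda>l. 2 * l + 1"]])
      show "\<exists>N. \<forall>n\<ge>N. ((\<lambda>l. LINT E|\<kappa> l. g E) \<circ> (\<lambda>l. 2 * l + 1)) n \<le> 1 / 4"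
        using osc(2) by (simp add: avg)
    qed (simp add: strict_mono_def)
    ultimately show False by simp
  qed
  show ?thesis
  proof (rule exI[of _ ?M], rule exI[of _ T], rule exI[of _ f], rule exI[of _ F], rule exI[of _ \<kappa>],
      intro conjI allI impI; (elim conjE)?)
    show "sigma_finite_measure ?M"
      by (rule sigma_finite_measure_restrict_space) (simp_all add: sigma_finite_lborel)
    have "emeasure ?M (\<Union>n. A n) \<le> emeasure ?M (space ?M)"
      by (rule emeasure_space)
    then show "emeasure ?M (space ?M) = \<infinity>" using inf(1) by (simp add: top_unique)
    show "invertible_transformation ?M T" "measure_preserving_transformation ?M T"
      "ergodic_transformation ?M T" "conservative_transformation ?M T"
      unfolding T_def by (rule invertible_tower_map measure_preserving_tower_map
          ergodic_tower_map[OF \<alpha>] conservative_tower_map)+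
    show "f \<in> borel_measurable ?M" by (rule f)
    show "\<exists>C. \<forall>\<omega>\<in>space ?M. \<bar>f \<omega>\<bar> \<le> C" using f_le by blast
    show "incseq F" by (rule incF)
    show "(\<Union>l. F l) = space ?M" unfolding UF UA UB by auto
    show "\<not> (\<exists>\<nu>. finite_measure \<nu> \<and> sets \<nu> = sets borel \<and> weakly_converges \<kappa> \<nu>)"
      using not_weak by blast
    fix l
    show "F l \<in> sets ?M" "0 < emeasure ?M (F l)" "emeasure ?M (F l) < \<infinity>"
      using F by blast+
    show "prob_space (\<kappa> l)" "sets (\<kappa> l) = sets borel"
      using \<kappa>[of l] by (simp_all add: real_distribution_def real_distribution_axioms_def)
    fix g :: "real \<Rightarrow> real"
    assume g: "continuous_on UNIV g" "compact (closure {x. g x \<noteq> 0})"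
    note \<kappa>_int = \<kappa>_int[OF g(1) bounded_range_compact_support[OF g], of l]
    show "set_integrable ?M (F l)
         (\<lambda>\<omega>. cinner (ell2_basis 0) (fun_calc g (orbit_operator ?M T f \<omega>) (ell2_basis 0)))"
      unfolding H by (rule \<kappa>_int(1))
    show "complex_of_real (LINT E|\<kappa> l. g E) = complex_of_real (1 / measure ?M (F l)) *
         (LINT \<omega>:F l|?M. cinner (ell2_basis 0)
            (fun_calc g (orbit_operator ?M T f \<omega>) (ell2_basis 0)))"
      unfolding H by (rule \<kappa>_int(2))
  qed
qed

end
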